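(* Let $P,Q$ be distributions over $x=(x_1,x_2)$ with $x_1\in\mathbb{R}^{d_1}$, $x_2\in\mathbb{R}^{d_2}$. Assume $x$ is Gaussian with zero mean under both $P$ and $Q$, that $P$ and $Q$ have matching marginals on $x_1$ and on $x_2$ (the law of $x_1$ is the same under $P$ and $Q$, and likewise for $x_2$), and that $\mathbb{E}_P[x_1x_1^\top]=I_{d_1}$, $\mathbb{E}_P[x_2x_2^\top]=I_{d_2}$. Let $\Sigma_P=\mathbb{E}_P[xx^\top]$ and $\mathcal{F}=\{f_1(x_1)+f_2(x_2): f_i:\mathbb{R}^{d_i}\to\mathbb{R},\ \mathbb{E}_P[f_i(x_i)^2]<\infty,\ i=1,2\}$. Then $$\tau(P,Q,\mathcal{F})\le\frac{2}{\lambda_{\min}(\Sigma_P)}.$$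
   Context: $\tau(P,Q,\mathcal{F})=\sup_{f,g\in\mathcal{F}}\mathbb{E}_Q[(f(x)-g(x))^2]/\mathbb{E}_P[(f(x)-g(x))^2]$ with the convention $0/0=0$. $\lambda_{\min}$ is the smallest eigenvalue; the bound is $+\infty$ if it is $0$. *)

theory Defs
  imports "HOL-Probability.Probability"
begin

definition part1 :: "real ^ ('n::finite + 'm::finite) \<Rightarrow> real ^ 'n" where
  "part1 x = (\<chi> i. x $ Inl i)"

definition part2 :: "real ^ ('n::finite + 'm::finite) \<Rightarrow> real ^ 'm" where
  "part2 x = (\<chi> j. x $ Inr j)"

definition centered_gaussian :: "(real ^ 'k::finite) measure \<Rightarrow> bool" where
  "centered_gaussian M \<longleftrightarrow> prob_space M \<and> sets M = sets borel \<and>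
     (\<forall>u. \<exists>\<sigma>\<ge>0. distr M borel (\<lambda>x. u \<bullet> x) =
        (if \<sigma> = 0 then return borel 0 else density lborel (normal_density 0 \<sigma>)))"

definition second_moment :: "(real ^ 'k::finite) measure \<Rightarrow> real ^ 'k ^ 'k" where
  "second_moment M = (\<chi> i j. \<integral>x. x $ i * x $ j \<partial>M)"

definition mat_eigenvalue :: "real ^ 'k ^ 'k \<Rightarrow> real \<Rightarrow> bool" where
  "mat_eigenvalue A l \<longleftrightarrow> (\<exists>v. v \<noteq> 0 \<and> A *v v = l *\<^sub>R v)"

definition lambda_min :: "real ^ 'k ^ 'k \<Rightarrow> real" where
  "lambda_min A = Min {l. mat_eigenvalue A l}"

definition additive_class ::
  "(real ^ ('n::finite + 'm::finite)) measure \<Rightarrow> (real ^ ('n + 'm) \<Rightarrow> real) set" where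
  "additive_class P = {f. \<exists>f1 f2. f1 \<in> borel_measurable borel \<and> f2 \<in> borel_measurable borel \<and>
      (\<integral>\<^sup>+ x. ennreal ((f1 (part1 x))\<^sup>2) \<partial>P) < \<infinity> \<and>
      (\<integral>\<^sup>+ x. ennreal ((f2 (part2 x))\<^sup>2) \<partial>P) < \<infinity> \<and>
      f = (\<lambda>x. f1 (part1 x) + f2 (part2 x))}"

text \<open>Transfer coefficient tau(P,Q,F). Ratios are taken in ennreal, where a/0 = \<infinity>
  for a > 0 and 0/0 = 0, matching the stated convention.\<close>
definition transfer_coeff :: "'a measure \<Rightarrow> 'a measure \<Rightarrow> ('a \<Rightarrow> real) set \<Rightarrow> ennreal" where
  "transfer_coeff P Q F = (SUP f\<in>F. SUP g\<in>F.
      (\<integral>\<^sup>+ x. ennreal ((f x - g x)\<^sup>2) \<partial>Q) / (\<integral>\<^sup>+ x. ennreal ((f x - g x)\<^sup>2) \<partial>P))"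

end

(*
  Write h = f1(x1) + f2(x2) for a difference of two members of the class and l for the smallest
  eigenvalue of Sigma_P.  The means of f1, f2 and their variances depend only on the marginals, so
  Var_Q h <= 2 (Var f1 + Var f2), and it remains to prove Gebelein's inequality
  Var_P h >= l (Var f1 + Var f2); the mean term is harmless since l <= 1.

  By density of trigonometric polynomials in L2 one may take f1 and f2 trigonometric.  For
  h = sum_j a_j cos(w_j . x) + b_j sin(w_j . x) and a Gaussian with covariance form A, the variance is
  sum_jk alpha_j alpha_k (cosh A_jk - 1) + beta_j beta_k sinh A_jk with alpha_j = a_j exp(-A_jj/2),
  beta_j = b_j exp(-A_jj/2).  Expanding cosh and sinh in powers reduces the claim to the positive
  semidefiniteness of the kernels A^n - l I^n (n >= 1), where I is the inner product.
*)
theory Submission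
  imports Defs
begin

section \<open>Density of trigonometric polynomials in L2\<close>

text \<open>From A >= l I alone, the Schur powers satisfy only A^n >= l^n I^n, which is too weak for
  n >= 2 (take A = l I). The gain from l^n to l comes from frequencies supported in a single block,
  where A agrees with I. For this reason f1 and f2 are approximated separately, each under the law
  of its own block, so that no mixed frequency ever appears. Cosines and sines take the place of
  Hermite polynomials because \<open>centered_gaussian\<close> speaks only of the laws of the
  scalars u . x, and such a law gives the integrals of cos (u . x) and sin (u . x) at once; products
  of waves are again waves, so second moments need neither a joint density nor an orthogonal basis.
  Passing to variances matters twice: it removes the constant term of cosh, so that the comparison
  kernel vanishes between the blocks, and it separates off the mean, which P and Q share. The factor
  2 is the price of the unknown correlation between the blocks under Q; it comes from the
  parallelogram law.\<close>

inductive trig_poly :: "('a::euclidean_space \<Rightarrow> real) \<Rightarrow> bool" where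
  cos: "trig_poly (\<lambda>x. cos (w \<bullet> x))"
| sin: "trig_poly (\<lambda>x. sin (w \<bullet> x))"
| add: "trig_poly f \<Longrightarrow> trig_poly g \<Longrightarrow> trig_poly (\<lambda>x. f x + g x)"
| scale: "trig_poly f \<Longrightarrow> trig_poly (\<lambda>x. c * f x)"

lemma trig_poly_const: "trig_poly (\<lambda>x. c)"
  using trig_poly.scale[OF trig_poly.cos[of 0], of c] by simp

text \<open>Product-to-sum formulas. Multiplication is derived here instead of being a constructor,
  so every trigonometric polynomial stays a linear combination of single waves, the form in which
  Gaussian integrals are known.\<close>

lemma trig_poly_mult_basic:
  "trig_poly (\<lambda>x. cos (u \<bullet> x) * cos (w \<bullet> x))"
  "trig_poly (\<lambda>x. sin (u \<bullet> x) * sin (w \<bullet> x))"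
  "trig_poly (\<lambda>x. sin (u \<bullet> x) * cos (w \<bullet> x))"
proof -
  show "trig_poly (\<lambda>x. cos (u \<bullet> x) * cos (w \<bullet> x))"
    using trig_poly.scale[OF trig_poly.add[OF trig_poly.cos[of "u - w"] trig_poly.cos[of "u + w"]], of "1/2"]
    by (simp add: cos_times_cos inner_diff_left inner_add_left)
  show "trig_poly (\<lambda>x. sin (u \<bullet> x) * sin (w \<bullet> x))"
    using trig_poly.scale[OF trig_poly.add[OF trig_poly.cos[of "u - w"]
        trig_poly.scale[OF trig_poly.cos[of "u + w"], of "-1"]], of "1/2"]
    by (simp add: sin_times_sin inner_diff_left inner_add_left)
  show "trig_poly (\<lambda>x. sin (u \<bullet> x) * cos (w \<bullet> x))"
    using trig_poly.scale[OF trig_poly.add[OF trig_poly.sin[of "u + w"] trig_poly.sin[of "u - w"]], of "1/2"]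
    by (simp add: sin_times_cos inner_diff_left inner_add_left)
qed

lemma trig_poly_mult_cos:
  assumes "trig_poly g"
  shows "trig_poly (\<lambda>x. cos (w \<bullet> x) * g x)"
  using assms
proof induction
  case (cos u)
  show ?case by (rule trig_poly_mult_basic(1))
next
  case (sin u)
  show ?case using trig_poly_mult_basic(3)[of u w] by (simp only: mult.commute)
next
  case (add f g)
  then show ?case using trig_poly.add by (simp only: distrib_left)
next
  case (scale f c)
  then show ?case using trig_poly.scale[of _ c] by (simp only: mult.left_commute[of _ c])
qed

lemma trig_poly_mult_sin:
  assumes "trig_poly g"
  shows "trig_poly (\<lambda>x. sin (w \<bullet> x) * g x)"
  using assms
proof induction
  case (cos u)
  show ?case by (rule trig_poly_mult_basic(3))
next
  case (sin u)
  show ?case by (rule trig_poly_mult_basic(2))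
next
  case (add f g)
  then show ?case using trig_poly.add by (simp only: distrib_left)
next
  case (scale f c)
  then show ?case using trig_poly.scale[of _ c] by (simp only: mult.left_commute[of _ c])
qed

lemma trig_poly_mult:
  assumes "trig_poly f" "trig_poly g"
  shows "trig_poly (\<lambda>x. f x * g x)"
  using assms(1)
proof induction
  case (cos w)
  show ?case by (rule trig_poly_mult_cos[OF assms(2)])
next
  case (sin w)
  show ?case by (rule trig_poly_mult_sin[OF assms(2)])
next
  case (add f h)
  then show ?case using trig_poly.add by (simp only: distrib_right)
next
  case (scale f c)
  then show ?case using trig_poly.scale[of _ c] by (simp only: mult.assoc)
qed

lemma trig_poly_bounded:
  assumes "trig_poly f"
  obtains B where "\<And>x. \<bar>f x\<bar> \<le> B"
proof -
  from assms have "\<exists>B. \<forall>x. \<bar>f x\<bar> \<le> B"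
  proof induction
    case (add f g)
    then obtain B C where "\<forall>x. \<bar>f x\<bar> \<le> B" "\<forall>x. \<bar>g x\<bar> \<le> C" by blast
    then have "\<forall>x. \<bar>f x + g x\<bar> \<le> B + C"
      by (meson abs_triangle_ineq add_mono order_trans)
    then show ?case ..
  next
    case (scale f c)
    then obtain B where "\<forall>x. \<bar>f x\<bar> \<le> B" by blast
    then have "\<forall>x. \<bar>c * f x\<bar> \<le> \<bar>c\<bar> * B" by (simp add: abs_mult mult_left_mono)
    then show ?case ..
  qed (auto intro: exI[of _ 1])
  then show ?thesis using that by blast
qed

lemma trig_poly_measurable:
  assumes "sets M = sets borel" "trig_poly f"
  shows "f \<in> borel_measurable M"
proof -
  have "f \<in> borel_measurable borel"
    using assms(2) by (induction rule: trig_poly.induct) simp_all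
  then show ?thesis using measurable_cong_sets[OF assms(1) refl] by blast
qed

lemma trig_poly_real_polynomial:
  fixes q :: "real \<Rightarrow> real"
  assumes "real_polynomial_function q" "trig_poly p"
  shows "trig_poly (\<lambda>x. q (p x))"
  using assms(1)
proof induction
  case (linear f)
  then interpret bounded_linear f .
  have "f t = f 1 * t" for t using scaleR[of t 1] by (simp add: mult.commute)
  then have "(\<lambda>x. f (p x)) = (\<lambda>x. f 1 * p x)" by blast
  then show ?case using trig_poly.scale[OF assms(2), of "f 1"] by simp
qed (simp_all only: trig_poly_const trig_poly.add trig_poly_mult)

text \<open>Uniform approximation on the whole noncompact space: these are the real Bohr almost
  periodic functions. They are far from all bounded continuous functions, so Stone-Weierstrass does
  not give density directly; their positivity sets, however, generate the Borel sets.\<close>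

definition unif_trig :: "('a::euclidean_space \<Rightarrow> real) \<Rightarrow> bool" where
  "unif_trig f \<longleftrightarrow> (\<forall>e>0. \<exists>p. trig_poly p \<and> (\<forall>x. \<bar>f x - p x\<bar> \<le> e))"

lemma unif_trig_poly: "trig_poly p \<Longrightarrow> unif_trig p"
  unfolding unif_trig_def by force

text \<open>Weierstrass is applied on the range, not on the domain: f is bounded, so \<phi> is
  needed only on a compact interval, and a polynomial in a trigonometric polynomial is again
  one.\<close>

lemma unif_trig_compose:
  fixes \<phi> :: "real \<Rightarrow> real"
  assumes "unif_trig f" "continuous_on UNIV \<phi>"
  shows "unif_trig (\<lambda>x. \<phi> (f x))"
  unfolding unif_trig_def
proof (intro allI impI)
  fix e :: real assume e: "e > 0"
  obtain p0 where p0: "trig_poly p0" "\<And>x. \<bar>f x - p0 x\<bar> \<le> 1"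
    using assms(1)[unfolded unif_trig_def] zero_less_one by metis
  obtain B0 where B0: "\<And>x. \<bar>p0 x\<bar> \<le> B0" using trig_poly_bounded[OF p0(1)] by blast
  \<comment> \<open>f is within 1 of \<open>p0\<close>, and the finer approximant p will be within r
    <= 1 of f, so both take values in [-B, B].\<close>
  define B where "B = B0 + 2"
  have cont: "continuous_on {-B..B} \<phi>" using assms(2) continuous_on_subset by blast
  have unif: "uniformly_continuous_on {-B..B} \<phi>"
    by (rule compact_uniformly_continuous[OF cont]) simp
  have "e/2 > 0" using e by simp
  from uniformly_continuous_onE[OF unif this] obtain d where d: "d > 0"
    "\<And>s t. s \<in> {-B..B} \<Longrightarrow> t \<in> {-B..B} \<Longrightarrow> \<bar>s - t\<bar> < d \<Longrightarrow> \<bar>\<phi> s - \<phi> t\<bar> < e/2"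
    unfolding dist_real_def by (metis abs_minus_commute)
  \<comment> \<open>d/2 makes the distance strictly less than the modulus d; the cap 1 keeps p in
    the interval.\<close>
  define r where "r = min (d/2) 1"
  have r: "r > 0" "r < d" "r \<le> 1" using d(1) by (auto simp: r_def)
  obtain p where p: "trig_poly p" "\<And>x. \<bar>f x - p x\<bar> \<le> r"
    using assms(1)[unfolded unif_trig_def] r(1) by metis
  obtain q where q: "real_polynomial_function q" "\<And>t. t \<in> {-B..B} \<Longrightarrow> \<bar>\<phi> t - q t\<bar> < e/2"
    using Stone_Weierstrass_real_polynomial_function[OF _ cont, of "e/2"] e by auto
  have "\<bar>\<phi> (f x) - q (p x)\<bar> \<le> e" for x
  proof -
    have f: "f x \<in> {-B..B}" using p0(2)[of x] B0[of x] by (auto simp: B_def)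
    have px: "p x \<in> {-B..B}" using p0(2)[of x] B0[of x] p(2)[of x] r by (auto simp: B_def)
    have "\<bar>\<phi> (f x) - \<phi> (p x)\<bar> < e/2" using d(2)[OF f px] p(2)[of x] r by linarith
    then show ?thesis using q(2)[OF px] by linarith
  qed
  then show "\<exists>p. trig_poly p \<and> (\<forall>x. \<bar>\<phi> (f x) - p x\<bar> \<le> e)"
    by (intro exI[of _ "\<lambda>x. q (p x)"] conjI trig_poly_real_polynomial[OF q(1) p(1)]) auto
qed

lemma unif_trig_add:
  assumes "unif_trig f" "unif_trig g"
  shows "unif_trig (\<lambda>x. f x + g x)"
  unfolding unif_trig_def
proof (intro allI impI)
  fix e :: real assume "e > 0"
  then have "e/2 > 0" by simp
  then obtain p q where pq: "trig_poly p" "\<And>x. \<bar>f x - p x\<bar> \<le> e/2"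
    "trig_poly q" "\<And>x. \<bar>g x - q x\<bar> \<le> e/2"
    using assms unfolding unif_trig_def by metis
  have "\<bar>(f x + g x) - (p x + q x)\<bar> \<le> e" for x using pq(2,4)[of x] by linarith
  then show "\<exists>p. trig_poly p \<and> (\<forall>x. \<bar>f x + g x - p x\<bar> \<le> e)"
    using trig_poly.add[OF pq(1,3)] by blast
qed

text \<open>Polarization, 4 f g = (f + g)^2 - (f - g)^2, reduces products to composition with the
  square.\<close>

lemma unif_trig_mult:
  assumes "unif_trig f" "unif_trig g"
  shows "unif_trig (\<lambda>x. f x * g x)"
proof -
  have minus: "unif_trig (\<lambda>x. - h x)" if "unif_trig h" for h :: "'a \<Rightarrow> real"
    using unif_trig_compose[OF that continuous_on_minus[OF continuous_on_id]] by simp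
  have sq: "unif_trig (\<lambda>x. (h x)\<^sup>2 / 4)" if "unif_trig h" for h :: "'a \<Rightarrow> real"
    by (rule unif_trig_compose[OF that, of "\<lambda>t. t\<^sup>2 / 4"]) (intro continuous_intros, simp)
  have "unif_trig (\<lambda>x. (f x + g x)\<^sup>2 / 4 + - ((f x + - g x)\<^sup>2 / 4))"
    by (intro unif_trig_add minus sq assms)
  then show ?thesis by (simp add: power2_eq_square field_simps)
qed

text \<open>Frequencies tending to zero recover the coordinates: \<open>n sin ((w \<bullet> x) / n) \<longlonglongrightarrow> w \<bullet> x\<close>.\<close>
lemma borel_subset_sigma_unif_trig:
  "sets (borel :: 'a::euclidean_space measure) \<subseteq> sigma_sets UNIV {{x. 0 < f x} |f. unif_trig (f :: 'a \<Rightarrow> real)}"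
    (is "_ \<subseteq> sigma_sets _ ?G")
proof -
  define N where "N = sigma (UNIV :: 'a set) ?G"
  have sN: "sets N = sigma_sets UNIV ?G" "space N = UNIV" by (auto simp: N_def)
  have meas: "f \<in> borel_measurable N" if "unif_trig f" for f
    unfolding borel_measurable_iff_greater
  proof
    fix a
    \<comment> \<open>Subtracting a moves every superlevel set to level 0, the only level among the
      generators.\<close>
    have "unif_trig (\<lambda>x. f x + - a)" by (intro unif_trig_add that unif_trig_poly trig_poly_const)
    moreover have "{w \<in> space N. a < f w} = {x. 0 < f x + - a}" by (auto simp: sN)
    ultimately show "{w \<in> space N. a < f w} \<in> sets N"
      unfolding sN(1) by (intro sigma_sets.Basic CollectI exI[of _ "\<lambda>x. f x + - a"]) auto
  qed
  have lim: "(\<lambda>n. real (Suc n) * sin ((w /\<^sub>R real (Suc n)) \<bullet> x)) \<longlonglongrightarrow> w \<bullet> x" for w x :: 'a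
  proof -
    have "((\<lambda>t. sin (w \<bullet> x * t)) has_real_derivative w \<bullet> x) (at 0)"
      by (auto intro!: derivative_eq_intros)
    then have "((\<lambda>t. sin (w \<bullet> x * t) / t) \<longlongrightarrow> w \<bullet> x) (at 0)"
      by (simp add: has_field_derivative_iff)
    moreover have "filterlim (\<lambda>n. inverse (real (Suc n))) (at 0) sequentially"
      by (intro filterlim_atI LIMSEQ_inverse_real_of_nat) auto
    ultimately have "(\<lambda>n. sin (w \<bullet> x * inverse (real (Suc n))) / inverse (real (Suc n))) \<longlonglongrightarrow> w \<bullet> x"
      by (rule filterlim_compose)
    then show ?thesis by (simp add: field_simps)
  qed
  have "(\<lambda>x. x \<bullet> i) \<in> borel_measurable N" for i :: 'a
  proof (rule borel_measurable_LIMSEQ_real)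
    show "(\<lambda>n. real (Suc n) * sin ((i /\<^sub>R real (Suc n)) \<bullet> x)) \<longlonglongrightarrow> x \<bullet> i" for x
      using lim[of i x] by (simp only: inner_commute)
    show "(\<lambda>x. real (Suc n) * sin ((i /\<^sub>R real (Suc n)) \<bullet> x)) \<in> borel_measurable N" for n
      by (intro meas unif_trig_poly trig_poly.intros)
  qed
  then have "(\<lambda>x. x) \<in> borel_measurable N"
    by (subst borel_measurable_euclidean_space) auto
  then have "(\<lambda>x. x) -` A \<inter> space N \<in> sets N" if "A \<in> sets borel" for A
    using that by (rule measurable_sets)
  then show ?thesis unfolding sN by auto
qed

text \<open>Closure in squared L2 distance. The extended integral makes the distance meaningful
  before square integrability is known.\<close>

definition trig_L2 :: "'a::euclidean_space measure \<Rightarrow> ('a \<Rightarrow> real) \<Rightarrow> bool" where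
  "trig_L2 M f \<longleftrightarrow> f \<in> borel_measurable M \<and>
     (\<forall>e>0. \<exists>p. trig_poly p \<and> (\<integral>\<^sup>+x. ennreal ((f x - p x)\<^sup>2) \<partial>M) \<le> ennreal e)"

lemma trig_L2_measurable: "trig_L2 M f \<Longrightarrow> f \<in> borel_measurable M"
  by (simp add: trig_L2_def)

lemma power2_add_le: "(s + t)\<^sup>2 \<le> 2 * s\<^sup>2 + 2 * (t :: real)\<^sup>2"
  using zero_le_power2[of "s - t"] unfolding power2_sum power2_diff by linarith

lemma nn_integral_square_add_le:
  fixes f g :: "'a \<Rightarrow> real"
  assumes [measurable]: "f \<in> borel_measurable M" "g \<in> borel_measurable M"
  shows "(\<integral>\<^sup>+x. ennreal ((f x + g x)\<^sup>2) \<partial>M)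
    \<le> 2 * (\<integral>\<^sup>+x. ennreal ((f x)\<^sup>2) \<partial>M) + 2 * (\<integral>\<^sup>+x. ennreal ((g x)\<^sup>2) \<partial>M)"
proof -
  have "(\<integral>\<^sup>+x. ennreal ((f x + g x)\<^sup>2) \<partial>M) \<le> (\<integral>\<^sup>+x. 2 * ennreal ((f x)\<^sup>2) + 2 * ennreal ((g x)\<^sup>2) \<partial>M)"
  proof (rule nn_integral_mono)
    fix x
    have "ennreal ((f x + g x)\<^sup>2) \<le> ennreal (2 * (f x)\<^sup>2 + 2 * (g x)\<^sup>2)"
      by (intro ennreal_leI power2_add_le)
    then show "ennreal ((f x + g x)\<^sup>2) \<le> 2 * ennreal ((f x)\<^sup>2) + 2 * ennreal ((g x)\<^sup>2)"
      by (simp add: ennreal_plus ennreal_mult)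
  qed
  also have "\<dots> = 2 * (\<integral>\<^sup>+x. ennreal ((f x)\<^sup>2) \<partial>M) + 2 * (\<integral>\<^sup>+x. ennreal ((g x)\<^sup>2) \<partial>M)"
    by (simp add: nn_integral_add nn_integral_cmult)
  finally show ?thesis .
qed

lemma trig_L2_approx:
  assumes M: "sets M = sets borel" and f: "f \<in> borel_measurable M"
    and g: "\<And>e. e > 0 \<Longrightarrow> \<exists>g. trig_L2 M g \<and> (\<integral>\<^sup>+x. ennreal ((f x - g x)\<^sup>2) \<partial>M) \<le> ennreal e"
  shows "trig_L2 M f"
  unfolding trig_L2_def
proof (intro conjI f allI impI)
  fix e :: real assume "e > 0"
  \<comment> \<open>The bound (s + t)^2 <= 2 s^2 + 2 t^2 doubles both errors, so two errors of e/4
    add up to e.\<close>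
  then have e: "e/4 > 0" by simp
  obtain g where g: "trig_L2 M g" "(\<integral>\<^sup>+x. ennreal ((f x - g x)\<^sup>2) \<partial>M) \<le> ennreal (e/4)"
    using g[OF e] by blast
  obtain p where p: "trig_poly p" "(\<integral>\<^sup>+x. ennreal ((g x - p x)\<^sup>2) \<partial>M) \<le> ennreal (e/4)"
    using g(1) e unfolding trig_L2_def by blast
  have [measurable]: "g \<in> borel_measurable M" "p \<in> borel_measurable M" "f \<in> borel_measurable M"
    using f by (auto intro: trig_L2_measurable[OF g(1)] trig_poly_measurable[OF M p(1)])
  have "(\<integral>\<^sup>+x. ennreal ((f x - p x)\<^sup>2) \<partial>M) = (\<integral>\<^sup>+x. ennreal (((f x - g x) + (g x - p x))\<^sup>2) \<partial>M)"
    by simp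
  also have "\<dots> \<le> 2 * (\<integral>\<^sup>+x. ennreal ((f x - g x)\<^sup>2) \<partial>M) + 2 * (\<integral>\<^sup>+x. ennreal ((g x - p x)\<^sup>2) \<partial>M)"
    by (rule nn_integral_square_add_le) measurable
  also have "\<dots> \<le> 2 * ennreal (e/4) + 2 * ennreal (e/4)"
    by (intro add_mono mult_left_mono g p) auto
  also have "\<dots> = ennreal (2 * (e/4) + 2 * (e/4))"
    using e by (simp only: ennreal_plus ennreal_mult ennreal_numeral)
  also have "\<dots> = ennreal e" by simp
  finally show "\<exists>p. trig_poly p \<and> (\<integral>\<^sup>+x. ennreal ((f x - p x)\<^sup>2) \<partial>M) \<le> ennreal e"
    using p(1) by blast
qed

text \<open>The dominating w also bounds the limit, so (f - u n)^2 <= 4 w^2 and dominated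
  convergence turns pointwise into L2 convergence. The closure is enlarged by this lemma from
  uniform limits to indicators and then to all of L2.\<close>

lemma trig_L2_limit:
  assumes M: "sets M = sets borel" and u: "\<And>n. trig_L2 M (u n)"
    and lim: "\<And>x. (\<lambda>n. u n x) \<longlonglongrightarrow> f x"
    and w: "\<And>n x. \<bar>u n x\<bar> \<le> w x" "w \<in> borel_measurable M" "(\<integral>\<^sup>+x. ennreal ((w x)\<^sup>2) \<partial>M) < \<infinity>"
  shows "trig_L2 M f"
proof (rule trig_L2_approx[OF M])
  note w(2)[measurable]
  have [measurable]: "u n \<in> borel_measurable M" for n using u unfolding trig_L2_def by blast
  show [measurable]: "f \<in> borel_measurable M"
    by (rule borel_measurable_LIMSEQ_real[where u=u]) (auto intro: lim)
  have "(\<lambda>n. \<integral>\<^sup>+x. ennreal ((f x - u n x)\<^sup>2) \<partial>M) \<longlonglongrightarrow> (\<integral>\<^sup>+x. 0 \<partial>M)"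
  proof (rule nn_integral_dominated_convergence[where w="\<lambda>x. ennreal (4 * (w x)\<^sup>2)"])
    have "ennreal ((f x - u n x)\<^sup>2) \<le> ennreal (4 * (w x)\<^sup>2)" for n x
    proof (rule ennreal_leI)
      have "\<bar>f x\<bar> \<le> w x"
        by (rule LIMSEQ_le_const2[OF tendsto_rabs[OF lim]]) (auto intro: w)
      then have "\<bar>f x - u n x\<bar> \<le> 2 * w x" using w(1)[of n x] by linarith
      then have "\<bar>f x - u n x\<bar>\<^sup>2 \<le> (2 * w x)\<^sup>2" by (intro power_mono) auto
      then show "(f x - u n x)\<^sup>2 \<le> 4 * (w x)\<^sup>2" by (simp add: power_mult_distrib)
    qed
    then show "AE x in M. ennreal ((f x - u n x)\<^sup>2) \<le> ennreal (4 * (w x)\<^sup>2)" for n by simp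
    show "(\<integral>\<^sup>+x. ennreal (4 * (w x)\<^sup>2) \<partial>M) < \<infinity>"
      using w(3) by (simp add: ennreal_mult nn_integral_cmult ennreal_mult_less_top)
    have "(\<lambda>n. ennreal ((f x - u n x)\<^sup>2)) \<longlonglongrightarrow> 0" for x
    proof -
      have "(\<lambda>n. (f x - u n x)\<^sup>2) \<longlonglongrightarrow> (f x - f x)\<^sup>2" by (intro tendsto_intros lim)
      then have "(\<lambda>n. ennreal ((f x - u n x)\<^sup>2)) \<longlonglongrightarrow> ennreal ((f x - f x)\<^sup>2)"
        by (rule tendsto_ennrealI)
      then show ?thesis by simp
    qed
    then show "AE x in M. (\<lambda>n. ennreal ((f x - u n x)\<^sup>2)) \<longlonglongrightarrow> 0" by simp
  qed measurable
  then have *: "(\<lambda>n. \<integral>\<^sup>+x. ennreal ((f x - u n x)\<^sup>2) \<partial>M) \<longlonglongrightarrow> 0" by simp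
  fix e :: real assume "e > 0"
  then have "eventually (\<lambda>n. (\<integral>\<^sup>+x. ennreal ((f x - u n x)\<^sup>2) \<partial>M) < ennreal e) sequentially"
    by (intro order_tendstoD(2)[OF *]) simp
  then obtain n where "(\<integral>\<^sup>+x. ennreal ((f x - u n x)\<^sup>2) \<partial>M) < ennreal e"
    by (auto dest: eventually_happens)
  then show "\<exists>g. trig_L2 M g \<and> (\<integral>\<^sup>+x. ennreal ((f x - g x)\<^sup>2) \<partial>M) \<le> ennreal e"
    using u less_imp_le by blast
qed

lemma trig_L2_scale:
  assumes M: "sets M = sets borel" and f: "trig_L2 M f"
  shows "trig_L2 M (\<lambda>x. c * f x)"
  unfolding trig_L2_def
proof (intro conjI allI impI)
  show "(\<lambda>x. c * f x) \<in> borel_measurable M" using trig_L2_measurable[OF f] by measurable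
  fix e :: real assume e: "e > 0"
  \<comment> \<open>Dividing by c^2 + 1 instead of c^2 covers c = 0 without a case split.\<close>
  have pos: "c\<^sup>2 + 1 > 0" by (simp add: add_nonneg_pos)
  then have "e / (c\<^sup>2 + 1) > 0" using e by simp
  then obtain p where p: "trig_poly p" "(\<integral>\<^sup>+x. ennreal ((f x - p x)\<^sup>2) \<partial>M) \<le> ennreal (e / (c\<^sup>2 + 1))"
    using f unfolding trig_L2_def by blast
  have [measurable]: "f \<in> borel_measurable M" "p \<in> borel_measurable M"
    by (auto intro: trig_L2_measurable[OF f] trig_poly_measurable[OF M p(1)])
  have "(\<integral>\<^sup>+x. ennreal ((c * f x - c * p x)\<^sup>2) \<partial>M) = (\<integral>\<^sup>+x. ennreal (c\<^sup>2) * ennreal ((f x - p x)\<^sup>2) \<partial>M)"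
    by (simp add: ennreal_mult[symmetric] power_mult_distrib[symmetric] right_diff_distrib)
  also have "\<dots> = ennreal (c\<^sup>2) * (\<integral>\<^sup>+x. ennreal ((f x - p x)\<^sup>2) \<partial>M)"
    by (rule nn_integral_cmult) measurable
  also have "\<dots> \<le> ennreal (c\<^sup>2) * ennreal (e / (c\<^sup>2 + 1))"
    by (intro mult_left_mono p) auto
  also have "\<dots> = ennreal (c\<^sup>2 * (e / (c\<^sup>2 + 1)))"
    using e pos by (intro ennreal_mult[symmetric]) auto
  also have "\<dots> \<le> ennreal e"
    using e pos by (intro ennreal_leI) (simp add: field_simps)
  finally show "\<exists>p. trig_poly p \<and> (\<integral>\<^sup>+x. ennreal ((c * f x - p x)\<^sup>2) \<partial>M) \<le> ennreal e"
    by (intro exI[of _ "\<lambda>x. c * p x"] conjI trig_poly.scale p)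
qed

lemma trig_L2_add:
  assumes M: "sets M = sets borel" and f: "trig_L2 M f" and g: "trig_L2 M g"
  shows "trig_L2 M (\<lambda>x. f x + g x)"
  unfolding trig_L2_def
proof (intro conjI allI impI)
  show "(\<lambda>x. f x + g x) \<in> borel_measurable M" using trig_L2_measurable[OF f] trig_L2_measurable[OF g] by measurable
  fix e :: real assume "e > 0"
  then have e: "e / 4 > 0" by simp
  obtain p where p: "trig_poly p" "(\<integral>\<^sup>+x. ennreal ((f x - p x)\<^sup>2) \<partial>M) \<le> ennreal (e/4)"
    using f e unfolding trig_L2_def by blast
  obtain q where q: "trig_poly q" "(\<integral>\<^sup>+x. ennreal ((g x - q x)\<^sup>2) \<partial>M) \<le> ennreal (e/4)"
    using g e unfolding trig_L2_def by blast
  have [measurable]: "f \<in> borel_measurable M" "g \<in> borel_measurable M"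
    "p \<in> borel_measurable M" "q \<in> borel_measurable M"
    by (auto intro: trig_L2_measurable[OF f] trig_L2_measurable[OF g]
        trig_poly_measurable[OF M p(1)] trig_poly_measurable[OF M q(1)])
  have "(\<integral>\<^sup>+x. ennreal ((f x + g x - (p x + q x))\<^sup>2) \<partial>M)
      = (\<integral>\<^sup>+x. ennreal (((f x - p x) + (g x - q x))\<^sup>2) \<partial>M)"
    by (simp add: algebra_simps)
  also have "\<dots> \<le> 2 * (\<integral>\<^sup>+x. ennreal ((f x - p x)\<^sup>2) \<partial>M) + 2 * (\<integral>\<^sup>+x. ennreal ((g x - q x)\<^sup>2) \<partial>M)"
    by (rule nn_integral_square_add_le) measurable
  also have "\<dots> \<le> 2 * ennreal (e/4) + 2 * ennreal (e/4)"
    by (intro add_mono mult_left_mono q p) auto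
  also have "\<dots> = ennreal (2 * (e/4) + 2 * (e/4))"
    using e by (simp only: ennreal_plus ennreal_mult ennreal_numeral)
  also have "\<dots> = ennreal e" by simp
  finally show "\<exists>p. trig_poly p \<and> (\<integral>\<^sup>+x. ennreal ((f x + g x - p x)\<^sup>2) \<partial>M) \<le> ennreal e"
    by (intro exI[of _ "\<lambda>x. p x + q x"] conjI trig_poly.add p q)
qed

lemma trig_L2_trig_poly:
  assumes "sets M = sets borel" "trig_poly p"
  shows "trig_L2 M p"
  unfolding trig_L2_def
proof (intro conjI allI impI)
  show "p \<in> borel_measurable M" by (rule trig_poly_measurable[OF assms])
  show "\<exists>q. trig_poly q \<and> (\<integral>\<^sup>+x. ennreal ((p x - q x)\<^sup>2) \<partial>M) \<le> ennreal e" for e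
    by (rule exI[of _ p]) (simp add: assms)
qed

lemma trig_L2_sum:
  assumes M: "sets M = sets borel" and "finite I" "\<And>i. i \<in> I \<Longrightarrow> trig_L2 M (f i)"
  shows "trig_L2 M (\<lambda>x. \<Sum>i\<in>I. f i x)"
  using assms(2,3)
  by (induction I) (auto intro: trig_L2_trig_poly[OF M trig_poly_const] trig_L2_add[OF M])

context
  fixes M :: "'a::euclidean_space measure"
  assumes fin: "finite_measure M" and M: "sets M = sets borel"
begin

interpretation finite_measure M by (rule fin)

lemma square_const_finite: "(\<integral>\<^sup>+x. ennreal ((c::real)\<^sup>2) \<partial>M) < \<infinity>"
  using emeasure_finite[of "space M"] by (simp add: ennreal_mult_less_top ennreal_mult_eq_top_iff less_top[symmetric])

lemma trig_L2_unif:
  assumes "unif_trig f"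
  shows "trig_L2 M f"
proof -
  have "\<exists>p. trig_poly p \<and> (\<forall>x. \<bar>f x - p x\<bar> \<le> inverse (real (Suc n)))" for n
    by (rule assms[unfolded unif_trig_def, rule_format]) simp
  then obtain p where p: "\<And>n. trig_poly (p n)" "\<And>n x. \<bar>f x - p n x\<bar> \<le> inverse (real (Suc n))"
    by metis
  obtain B where B: "\<And>x. \<bar>p 0 x\<bar> \<le> B" using trig_poly_bounded[OF p(1)] by blast
  show ?thesis
  \<comment> \<open>B + 2 bounds |p n| <= |p n - f| + |f - p 0| + |p 0|, where the first two terms
    are at most 1.\<close>
  proof (rule trig_L2_limit[OF M trig_L2_trig_poly[OF M p(1)], where w="\<lambda>_. B + 2"])
    fix x n
    have "\<bar>p n x - f x\<bar> \<le> inverse (real (Suc n))" for n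
      using p(2)[of x n] by (simp only: abs_minus_commute)
    then show "(\<lambda>n. p n x) \<longlonglongrightarrow> f x"
      by (intro LIM_zero_cancel[OF Lim_null_comparison[OF _ LIMSEQ_inverse_real_of_nat]] always_eventually)
        (simp only: real_norm_def simp_thms)
    have "inverse (real (Suc n)) \<le> 1" by (simp add: inverse_eq_divide)
    then show "\<bar>p n x\<bar> \<le> B + 2"
      using p(2)[of x 0] p(2)[of x n] B[of x] by simp
  qed (use square_const_finite in auto)
qed

text \<open>Dynkin's pi-lambda argument: the positivity sets of uniformly approximable functions are
  stable under intersection and generate the Borel sets, while the sets whose indicator lies in the
  closure admit complements and countable disjoint unions.\<close>

lemma trig_L2_indicator:
  assumes "A \<in> sets M"
  shows "trig_L2 M (indicat_real A)"
proof -
  let ?G = "{{x. 0 < f x} |f. unif_trig (f :: 'a \<Rightarrow> real)}"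
  have "Int_stable ?G"
  proof (rule Int_stableI, clarsimp)
    fix f g :: "'a \<Rightarrow> real" assume fg: "unif_trig f" "unif_trig g"
    have pos: "unif_trig (\<lambda>x. max (h x) 0)" if "unif_trig h" for h :: "'a \<Rightarrow> real"
      by (rule unif_trig_compose[OF that, of "\<lambda>t. max t 0"]) (intro continuous_intros)
    \<comment> \<open>A product of positive parts is positive exactly where both factors are; this
      is what closure under products and continuous composition was proved for.\<close>
    have "{x. 0 < f x} \<inter> {x. 0 < g x} = {x. 0 < max (f x) 0 * max (g x) 0}"
      by (auto simp: zero_less_mult_iff)
    then show "\<exists>h. {x. 0 < f x} \<inter> {x. 0 < g x} = {x. 0 < h x} \<and> unif_trig h"
      by (intro exI[of _ "\<lambda>x. max (f x) 0 * max (g x) 0"] conjI unif_trig_mult pos fg)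
  qed
  moreover have "?G \<subseteq> Pow UNIV" by simp
  moreover have "A \<in> sigma_sets UNIV ?G" using assms M borel_subset_sigma_unif_trig by blast
  ultimately show ?thesis
  proof (induction rule: sigma_sets_induct_disjoint)
    case (basic A)
    then obtain f where A: "A = {x. 0 < f x}" and f: "unif_trig f" by blast
    \<comment> \<open>The ramps n max(f, 0), capped at 1, tend to the indicator of the positivity
      set of f, and each is a continuous function of f.\<close>
    have "trig_L2 M (\<lambda>x. min 1 (real n * max (f x) 0))" for n
      by (rule trig_L2_unif, rule unif_trig_compose[OF f, of "\<lambda>t. min 1 (real n * max t 0)"])
        (intro continuous_intros)
    then show ?case
    proof (rule trig_L2_limit[OF M, where w="\<lambda>_. 1"])
      fix x
      show "(\<lambda>n. min 1 (real n * max (f x) 0)) \<longlonglongrightarrow> indicat_real A x"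
      proof (cases "0 < f x")
        case True
        have "eventually (\<lambda>n. min 1 (real n * max (f x) 0) = 1) sequentially"
        proof (rule eventually_sequentiallyI[of "nat \<lceil>1 / f x\<rceil>"])
          fix n assume "nat \<lceil>1 / f x\<rceil> \<le> n"
          then have "1 / f x \<le> real n" by linarith
          then show "min 1 (real n * max (f x) 0) = 1" using True by (simp add: field_simps)
        qed
        then show ?thesis using True by (simp add: A tendsto_eventually)
      next
        case False
        then show ?thesis by (simp add: A max_def)
      qed
      show "\<bar>min 1 (real n * max (f x) 0)\<bar> \<le> 1" for n by (simp add: min_def)
    qed (use square_const_finite[of 1] in auto)
  next
    case empty
    then show ?case using trig_L2_trig_poly[OF M trig_poly_const, of 0] by simp
  next
    case (compl A)
    have "indicat_real (UNIV - A) = (\<lambda>x. 1 + -1 * indicat_real A x)"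
      by (auto simp: indicator_def)
    then show ?case
      using trig_L2_add[OF M trig_L2_trig_poly[OF M trig_poly_const] trig_L2_scale[OF M compl(2)], of 1 "-1"]
      by (simp only:)
  next
    case (union A)
    have "indicat_real (\<Union>i<n. A i) = (\<lambda>x. \<Sum>i<n. indicat_real (A i) x)" for n
      using union(1) by (intro ext indicator_UN_disjoint)
        (auto simp: disjoint_family_on_def)
    then have fin: "trig_L2 M (indicat_real (\<Union>i<n. A i))" for n
      using trig_L2_sum[OF M, of "{..<n}"] union(3) by simp
    show ?case
      by (rule trig_L2_limit[OF M fin LIMSEQ_indicator_UN, where w="\<lambda>_. 1"])
        (use square_const_finite[of 1] in auto)
  qed
qed

text \<open>f is a pointwise limit of simple functions bounded by 2 |f|, and 2 |f| is itself the
  square integrable dominating function. The measure is general so that the result applies to image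
  laws.\<close>

theorem trig_poly_dense_L2:
  assumes f: "f \<in> borel_measurable M" "(\<integral>\<^sup>+x. ennreal ((f x)\<^sup>2) \<partial>M) < \<infinity>"
  shows "trig_L2 M f"
proof -
  have sp: "space M = UNIV" using sets_eq_imp_space_eq[OF M] by simp
  obtain s where s: "\<And>i. simple_function M (s i)" "\<And>x. (\<lambda>i. s i x) \<longlonglongrightarrow> f x"
    "\<And>i x. dist (s i x) 0 \<le> 2 * dist (f x) 0"
    using borel_measurable_implies_sequence_metric[OF f(1), of 0] unfolding sp
    by (metis UNIV_I)
  have "trig_L2 M (s i)" for i
  proof -
    have "s i x = (\<Sum>y \<in> s i ` UNIV. y * indicat_real (s i -` {y}) x)" for x
      using simple_function_indicator_representation_banach[OF s(1)[of i], of x]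
      by (simp only: sp Int_UNIV_right UNIV_I simp_thms real_scaleR_def mult.commute)
    then have eq: "(\<lambda>x. \<Sum>y \<in> s i ` UNIV. y * indicat_real (s i -` {y}) x) = s i"
      by (intro ext) (rule sym)
    have "trig_L2 M (\<lambda>x. \<Sum>y \<in> s i ` UNIV. y * indicat_real (s i -` {y}) x)"
    proof (intro trig_L2_sum[OF M] trig_L2_scale[OF M] trig_L2_indicator)
      show "finite (range (s i))" using simple_functionD(1)[OF s(1)[of i]] by (simp add: sp)
      show "s i -` {y} \<in> sets M" for y using simple_functionD(2)[OF s(1)[of i], of "{y}"] by (simp add: sp)
    qed
    then show ?thesis by (rule back_subst[OF _ eq])
  qed
  then show ?thesis
  proof (rule trig_L2_limit[OF M _ s(2), where w="\<lambda>x. 2 * \<bar>f x\<bar>"])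
    show "\<bar>s i x\<bar> \<le> 2 * \<bar>f x\<bar>" for i x using s(3)[of i x] by simp
    show "(\<lambda>x. 2 * \<bar>f x\<bar>) \<in> borel_measurable M" using f(1) by simp
    show "(\<integral>\<^sup>+x. ennreal ((2 * \<bar>f x\<bar>)\<^sup>2) \<partial>M) < \<infinity>"
      using f by (simp add: power_mult_distrib ennreal_mult nn_integral_cmult ennreal_mult_less_top)
  qed
qed

end

text \<open>Density is used under the law of X, not under M, so the approximants are functions of X
  alone. With X the projection to a block, all their frequencies stay in that block.\<close>

lemma (in prob_space) trig_poly_approx_seq:
  fixes X :: "'a \<Rightarrow> 'b::euclidean_space"
  assumes X: "X \<in> borel_measurable M" and f: "f \<in> borel_measurable borel"
    and sq: "integrable M (\<lambda>x. (f (X x))\<^sup>2)"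
  obtains p where "\<And>n::nat. trig_poly (p n)" "(\<lambda>n. \<integral>x. (f (X x) - p n (X x))\<^sup>2 \<partial>M) \<longlonglongrightarrow> 0"
proof -
  let ?N = "distr M borel X"
  interpret N: prob_space ?N by (rule prob_space_distr[OF X])
  have "trig_L2 ?N f"
  proof (rule trig_poly_dense_L2)
    show "finite_measure ?N" by unfold_locales
    have "(\<integral>\<^sup>+x. ennreal ((f x)\<^sup>2) \<partial>?N) = (\<integral>\<^sup>+x. ennreal ((f (X x))\<^sup>2) \<partial>M)"
      by (rule nn_integral_distr[OF X]) (use f in measurable)
    also have "\<dots> < \<infinity>" using sq by (simp add: nn_integral_eq_integral)
    finally show "(\<integral>\<^sup>+x. ennreal ((f x)\<^sup>2) \<partial>?N) < \<infinity>" .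
  qed (use f in auto)
  then have "\<exists>p. trig_poly p \<and> (\<integral>\<^sup>+x. ennreal ((f x - p x)\<^sup>2) \<partial>?N) \<le> ennreal (inverse (real (Suc n)))" for n
    unfolding trig_L2_def by auto
  then obtain p where p: "\<And>n. trig_poly (p n)"
    "\<And>n. (\<integral>\<^sup>+x. ennreal ((f x - p n x)\<^sup>2) \<partial>?N) \<le> ennreal (inverse (real (Suc n)))" by metis
  have pm: "p n \<in> borel_measurable borel" for n by (rule trig_poly_measurable[OF refl p(1)])
  have "(\<integral>x. (f (X x) - p n (X x))\<^sup>2 \<partial>M) \<le> inverse (real (Suc n))" for n
  proof -
    have m: "(\<lambda>x. (f (X x) - p n (X x))\<^sup>2) \<in> borel_measurable M" using f pm X by measurable
    have "(\<integral>\<^sup>+x. ennreal ((f (X x) - p n (X x))\<^sup>2) \<partial>M) = (\<integral>\<^sup>+x. ennreal ((f x - p n x)\<^sup>2) \<partial>?N)"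
      by (rule nn_integral_distr[OF X, symmetric]) (use f pm in measurable)
    then have le: "(\<integral>\<^sup>+x. ennreal ((f (X x) - p n (X x))\<^sup>2) \<partial>M) \<le> ennreal (inverse (real (Suc n)))"
      using p(2)[of n] by simp
    have "integral\<^sup>L M (\<lambda>x. (f (X x) - p n (X x))\<^sup>2) = enn2real (\<integral>\<^sup>+x. ennreal ((f (X x) - p n (X x))\<^sup>2) \<partial>M)"
      by (rule integral_eq_nn_integral[OF m]) simp
    also have "\<dots> \<le> inverse (real (Suc n))" by (rule enn2real_leI[OF _ le]) simp
    finally show ?thesis .
  qed
  then have "(\<lambda>n. \<integral>x. (f (X x) - p n (X x))\<^sup>2 \<partial>M) \<longlonglongrightarrow> 0"
    by (intro tendsto_sandwich[OF _ _ tendsto_const LIMSEQ_inverse_real_of_nat] always_eventually) auto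
  with p(1) show ?thesis by (rule that)
qed

section \<open>Positive semidefinite forms\<close>

text \<open>Semidefinite and not definite: the covariance form minus its smallest eigenvalue times
  the inner product always degenerates on an eigenvector.\<close>

locale psd_form =
  fixes b :: "'a::euclidean_space \<Rightarrow> 'a \<Rightarrow> real"
  assumes bilin: "bilinear b" and sym: "b x y = b y x" and nonneg: "0 \<le> b x x"
begin

lemma cauchy_schwarz: "(b x y)\<^sup>2 \<le> b x x * b y y"
proof -
  have q: "0 \<le> b x x + 2 * t * b x y + t\<^sup>2 * b y y" for t
    using nonneg[of "x + t *\<^sub>R y"] sym[of y x]
    by (simp add: bilinear_ladd[OF bilin] bilinear_radd[OF bilin] bilinear_lmul[OF bilin]
        bilinear_rmul[OF bilin] power2_eq_square algebra_simps)
  show ?thesis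
  proof (cases "b y y = 0")
    case True
    have "b x y = 0"
    proof (rule ccontr)
      assume "b x y \<noteq> 0"
      \<comment> \<open>With b y y = 0 the quadratic is affine in t; this t gives it the value
        -1.\<close>
      then show False using q[of "- (b x x + 1) / (2 * b x y)"] True nonneg[of x]
        by (simp add: field_simps)
    qed
    then show ?thesis using True by simp
  next
    case False
    then have "b y y > 0" using nonneg[of y] by simp
    \<comment> \<open>This t minimizes the quadratic.\<close>
    then show ?thesis using q[of "- b x y / b y y"] by (simp add: field_simps power2_eq_square)
  qed
qed

lemma isotropic_imp_zero: "b y y = 0 \<Longrightarrow> b x y = 0"
  using cauchy_schwarz[of x y] by simp

end

text \<open>Lagrange (Cholesky) elimination, one basis vector at a time. S holds the basis vectors
  on which the form may still be nonzero; once S is empty, every basis vector is isotropic, hence in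
  the radical, and the form vanishes.\<close>

lemma psd_form_sum_of_squares_aux:
  assumes "finite S" "S \<subseteq> Basis" "psd_form b" "\<And>e. e \<in> Basis - S \<Longrightarrow> b e e = 0"
  shows "\<exists>gs. \<forall>x y :: 'a::euclidean_space. b x y = (\<Sum>g\<leftarrow>gs. g x * (g y :: real))"
  using assms
proof (induction S arbitrary: b rule: finite_induct)
  case empty
  then interpret psd_form b by simp
  have "b x y = 0" for x y
  proof -
    have "b x = (\<lambda>_. 0)"
      using bilin empty(3) isotropic_imp_zero
      by (intro linear_eq_stdbasis) (auto simp: bilinear_def linear_zero)
    then show ?thesis by simp
  qed
  then show ?case by (intro exI[of _ "[]"]) simp
next
  case (insert e S)
  interpret psd_form b by fact
  show ?case
  proof (cases "b e e = 0")
    case True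
    show ?thesis by (rule insert.IH) (use insert.prems True in auto)
  next
    case False
    then have pos: "b e e > 0" using nonneg[of e] by simp
    \<comment> \<open>The Schur complement of e: semidefinite by Cauchy-Schwarz, isotropic at e, and
      still isotropic at the vectors eliminated before, since those lie in the radical of b.\<close>
    define b' where "b' x y = b x y - b x e * b y e / b e e" for x y
    have "psd_form b'"
    proof
      have lin: "linear (\<lambda>x. b x y)" "linear (b x)" for x y using bilin by (auto simp: bilinear_def)
      have "linear (\<lambda>y. b x y - (b x e / b e e) * b y e)" for x
        by (intro linear_compose_sub lin linear_compose_scale_right[where 'b=real, simplified])
      moreover have "linear (\<lambda>x. b x y - (b y e / b e e) * b x e)" for y
        by (intro linear_compose_sub lin linear_compose_scale_right[where 'b=real, simplified])
      ultimately show "bilinear b'" unfolding bilinear_def b'_def by (simp add: mult.commute)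
      show "b' x y = b' y x" for x y using sym[of x y] by (simp add: b'_def mult.commute)
      show "0 \<le> b' x x" for x using cauchy_schwarz[of x e] pos
        by (simp add: b'_def field_simps power2_eq_square)
    qed
    moreover have "b' f f = 0" if "f \<in> Basis - S" for f
    proof (cases "f = e")
      case True then show ?thesis using pos by (simp add: b'_def)
    next
      case neq: False
      then have "b f f = 0" using insert.prems(3) that by simp
      then show ?thesis using isotropic_imp_zero[of f e] sym[of e f] by (simp add: b'_def)
    qed
    ultimately obtain gs where gs: "\<And>x y. b' x y = (\<Sum>g\<leftarrow>gs. g x * g y)"
      using insert.IH[of b'] insert.prems(1) by blast
    have "b x y = (\<Sum>g\<leftarrow>(\<lambda>x. b x e / sqrt (b e e)) # gs. g x * g y)" for x y
      using pos gs[of x y] by (simp add: b'_def)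
    then show ?thesis by blast
  qed
qed

lemma psd_form_sum_of_squares:
  assumes "psd_form (b :: 'a::euclidean_space \<Rightarrow> 'a \<Rightarrow> real)"
  obtains gs where "\<And>x y. b x y = (\<Sum>g\<leftarrow>gs. g x * g y)"
  using psd_form_sum_of_squares_aux[of Basis b] assms by auto

text \<open>Schur product theorem for powers of one kernel. Writing one factor as a sum of squares
  g(x) g(y) lets g be absorbed into the coefficients, which lowers the exponent; hence the induction
  over arbitrary \<alpha>.\<close>

lemma psd_form_power:
  fixes b :: "'a::euclidean_space \<Rightarrow> 'a \<Rightarrow> real"
  assumes "psd_form b" "finite J"
  shows "0 \<le> (\<Sum>j\<in>J. \<Sum>k\<in>J. \<alpha> j * \<alpha> k * b (w j) (w k) ^ n)"
proof -
  obtain gs where gs: "\<And>x y. b x y = (\<Sum>g\<leftarrow>gs. g x * g y)"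
    using psd_form_sum_of_squares[OF assms(1)] by metis
  show ?thesis
  proof (induction n arbitrary: \<alpha>)
    case 0
    have "(\<Sum>j\<in>J. \<Sum>k\<in>J. \<alpha> j * \<alpha> k * b (w j) (w k) ^ 0) = (\<Sum>j\<in>J. \<alpha> j)\<^sup>2"
      by (simp add: power2_eq_square sum_product)
    then show ?case by (metis zero_le_power2)
  next
    case (Suc n)
    have "(\<Sum>j\<in>J. \<Sum>k\<in>J. \<alpha> j * \<alpha> k * b (w j) (w k) ^ Suc n)
      = (\<Sum>j\<in>J. \<Sum>k\<in>J. \<Sum>i<length gs. (\<alpha> j * (gs ! i) (w j)) * (\<alpha> k * (gs ! i) (w k)) * b (w j) (w k) ^ n)"
    proof (intro sum.cong refl)
      fix j k
      define c where "c = b (w j) (w k) ^ n"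
      have "\<alpha> j * \<alpha> k * b (w j) (w k) ^ Suc n = (\<alpha> j * \<alpha> k * c) * (\<Sum>i<length gs. (gs ! i) (w j) * (gs ! i) (w k))"
        by (simp add: c_def gs sum_list_sum_nth atLeast0LessThan)
      then show "\<alpha> j * \<alpha> k * b (w j) (w k) ^ Suc n =
        (\<Sum>i<length gs. (\<alpha> j * (gs ! i) (w j)) * (\<alpha> k * (gs ! i) (w k)) * b (w j) (w k) ^ n)"
        unfolding c_def[symmetric] by (simp add: sum_distrib_left mult_ac)
    qed
    also have "\<dots> = (\<Sum>j\<in>J. \<Sum>i<length gs. \<Sum>k\<in>J. (\<alpha> j * (gs ! i) (w j)) * (\<alpha> k * (gs ! i) (w k)) * b (w j) (w k) ^ n)"
      by (rule sum.cong[OF refl]) (rule sum.swap)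
    also have "\<dots> = (\<Sum>i<length gs. \<Sum>j\<in>J. \<Sum>k\<in>J. (\<alpha> j * (gs ! i) (w j)) * (\<alpha> k * (gs ! i) (w k)) * b (w j) (w k) ^ n)"
      by (rule sum.swap)
    also have "0 \<le> \<dots>"
      by (rule sum_nonneg) (rule Suc.IH)
    finally show ?case .
  qed
qed

section \<open>Smallest eigenvalue and Rayleigh quotient\<close>

lemma symmetric_matrix_form:
  fixes A :: "real ^ 'k ^ 'k"
  assumes "transpose A = A"
  shows "x \<bullet> (A *v y) = y \<bullet> (A *v x)"
  by (metis assms dot_lmul_matrix inner_commute transpose_matrix_vector)

text \<open>Eigenvectors for distinct eigenvalues are orthogonal, and a pairwise orthogonal set is
  finite. Needed because \<open>lambda_min\<close> is a \<open>Min\<close>, which says something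
  only about finite sets.\<close>

lemma finite_mat_eigenvalues:
  fixes A :: "real ^ 'k ^ 'k"
  assumes "transpose A = A"
  shows "finite {l. mat_eigenvalue A l}"
proof -
  let ?E = "{l. mat_eigenvalue A l}"
  have "\<forall>l\<in>?E. \<exists>v. v \<noteq> 0 \<and> A *v v = l *\<^sub>R v" by (simp add: mat_eigenvalue_def)
  then obtain v where v: "\<And>l. l \<in> ?E \<Longrightarrow> v l \<noteq> 0" "\<And>l. l \<in> ?E \<Longrightarrow> A *v v l = l *\<^sub>R v l"
    by metis
  have orth: "v l \<bullet> v m = 0" if "l \<in> ?E" "m \<in> ?E" "l \<noteq> m" for l m
  proof -
    have "m * (v l \<bullet> v m) = l * (v l \<bullet> v m)"
      using symmetric_matrix_form[OF assms, of "v l" "v m"] v(2) that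
      by (simp add: inner_commute)
    then show ?thesis using that by simp
  qed
  have "inj_on v ?E"
  proof (rule inj_onI, rule ccontr)
    fix l m assume "l \<in> ?E" "m \<in> ?E" "v l = v m" "l \<noteq> m"
    then show False using orth[of l m] v(1)[of m] by simp
  qed
  moreover have "finite (v ` ?E)"
    by (rule pairwise_orthogonal_imp_finite)
       (auto simp: pairwise_def orthogonal_def intro!: orth[simplified])
  ultimately show ?thesis using finite_imageD by blast
qed

lemma psd_form_matrix:
  fixes A :: "real ^ 'k::finite ^ 'k"
  assumes "transpose A = A" "\<And>x. 0 \<le> x \<bullet> (A *v x)"
  shows "psd_form (\<lambda>x y. x \<bullet> (A *v y))"
proof
  show "bilinear (\<lambda>x y. x \<bullet> (A *v y))"
    by (auto simp: bilinear_def linear_iff inner_add_left inner_add_right matrix_vector_right_distrib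
        matrix_vector_mult_scaleR)
qed (use assms symmetric_matrix_form[OF assms(1)] in auto)

text \<open>The minimum m of the form on the unit sphere is an eigenvalue, so
  \<open>lambda_min\<close> is at most m. In place of Lagrange multipliers: A - m I is semidefinite
  and isotropic at a minimizer, so the minimizer lies in its radical.\<close>

lemma lambda_min_le_rayleigh:
  fixes A :: "real ^ 'k::finite ^ 'k"
  assumes sym: "transpose A = A"
  shows "lambda_min A * (x \<bullet> x) \<le> x \<bullet> (A *v x)"
proof -
  have "compact (sphere (0 :: real ^ 'k) 1)" by simp
  moreover have "sphere (0 :: real ^ 'k) 1 \<noteq> {}" by simp
  moreover have "continuous_on (sphere 0 1) (\<lambda>x. x \<bullet> (A *v x))"
    by (intro continuous_intros linear_continuous_on matrix_vector_mul_bounded_linear)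
  ultimately obtain v where v: "norm v = 1" "\<And>x. norm x = 1 \<Longrightarrow> v \<bullet> (A *v v) \<le> x \<bullet> (A *v x)"
    by (metis continuous_attains_inf mem_sphere_0)
  define m where "m = v \<bullet> (A *v v)"
  have ray: "m * (x \<bullet> x) \<le> x \<bullet> (A *v x)" for x
  proof (cases "x = 0")
    case False
    have "m \<le> (x /\<^sub>R norm x) \<bullet> (A *v (x /\<^sub>R norm x))"
      unfolding m_def using False by (intro v(2)) simp
    also have "\<dots> = x \<bullet> (A *v x) / (x \<bullet> x)"
      by (simp add: matrix_vector_mult_scaleR dot_square_norm power2_eq_square divide_inverse)
    finally show ?thesis using False by (simp add: field_simps)
  qed simp
  define B where "B = A - m *\<^sub>R mat 1"
  have B: "B *v x = A *v x - m *\<^sub>R x" for x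
    by (simp add: B_def matrix_vector_mult_diff_rdistrib scaleR_matrix_vector_assoc[symmetric])
  have "psd_form (\<lambda>x y. x \<bullet> (B *v y))"
  proof (rule psd_form_matrix)
    show "transpose B = B"
      using sym unfolding B_def transpose_def mat_def by (auto simp: vec_eq_iff)
    show "0 \<le> x \<bullet> (B *v x)" for x using ray[of x] by (simp add: B inner_diff_right)
  qed
  then interpret B: psd_form "\<lambda>x y. x \<bullet> (B *v y)" .
  have "v \<bullet> (B *v v) = 0" using v(1) by (simp add: B inner_diff_right m_def dot_square_norm)
  \<comment> \<open>The radical property is tested against B v itself, giving |B v|^2 = 0.\<close>
  then have "B *v v = 0" using B.isotropic_imp_zero[of v "B *v v"] by simp
  then have "mat_eigenvalue A m"
    unfolding mat_eigenvalue_def using v(1) by (intro exI[of _ v]) (auto simp: B)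
  then have "lambda_min A \<le> m"
    unfolding lambda_min_def by (intro Min_le finite_mat_eigenvalues[OF sym]) simp
  then have "lambda_min A * (x \<bullet> x) \<le> m * (x \<bullet> x)" by (intro mult_right_mono) auto
  then show ?thesis using ray[of x] by linarith
qed

section \<open>Variance\<close>

text \<open>Raw moments instead of the centred square: each term is an integral that can be computed
  for trigonometric sums and carried from P to Q by equality of marginals.\<close>

definition var :: "'a measure \<Rightarrow> ('a \<Rightarrow> real) \<Rightarrow> real" where
  "var M f = (\<integral>x. (f x)\<^sup>2 \<partial>M) - (\<integral>x. f x \<partial>M)\<^sup>2"

lemma (in prob_space) integral_mult_square_le:
  fixes f g :: "'a \<Rightarrow> real"
  assumes [measurable]: "f \<in> borel_measurable M" "g \<in> borel_measurable M"
    and f: "integrable M (\<lambda>x. (f x)\<^sup>2)" and g: "integrable M (\<lambda>x. (g x)\<^sup>2)"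
  shows "integrable M (\<lambda>x. f x * g x)" "(\<integral>x. f x * g x \<partial>M)\<^sup>2 \<le> (\<integral>x. (f x)\<^sup>2 \<partial>M) * (\<integral>x. (g x)\<^sup>2 \<partial>M)"
proof -
  show fg: "integrable M (\<lambda>x. f x * g x)"
  proof (rule Bochner_Integration.integrable_bound)
    show "integrable M (\<lambda>x. (f x)\<^sup>2 + (g x)\<^sup>2)" using f g by simp
    have "\<bar>f x * g x\<bar> \<le> (f x)\<^sup>2 + (g x)\<^sup>2" for x
    proof -
      have "0 \<le> (\<bar>f x\<bar> - \<bar>g x\<bar>)\<^sup>2" by simp
      then have "2 * (\<bar>f x\<bar> * \<bar>g x\<bar>) \<le> (f x)\<^sup>2 + (g x)\<^sup>2"
        unfolding power2_diff by simp
      moreover have "0 \<le> \<bar>f x\<bar> * \<bar>g x\<bar>" by simp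
      ultimately show ?thesis unfolding abs_mult by linarith
    qed
    then show "AE x in M. norm (f x * g x) \<le> norm ((f x)\<^sup>2 + (g x)\<^sup>2)" by simp
  qed measurable
  have abs_fg: "integrable M (\<lambda>x. \<bar>f x\<bar> * \<bar>g x\<bar>)"
    using integrable_abs[OF fg] by (simp add: abs_mult)
  have "ennreal ((\<integral>x. \<bar>f x * g x\<bar> \<partial>M)\<^sup>2) = (\<integral>\<^sup>+x. ennreal \<bar>f x\<bar> * ennreal \<bar>g x\<bar> \<partial>M)\<^sup>2"
    using nn_integral_eq_integral[OF abs_fg]
    by (simp add: ennreal_power[symmetric] ennreal_mult[symmetric] abs_mult)
  also have "\<dots> \<le> (\<integral>\<^sup>+x. (ennreal \<bar>f x\<bar>)\<^sup>2 \<partial>M) * (\<integral>\<^sup>+x. (ennreal \<bar>g x\<bar>)\<^sup>2 \<partial>M)"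
    by (rule Cauchy_Schwarz_nn_integral) measurable
  also have "\<dots> = ennreal ((\<integral>x. (f x)\<^sup>2 \<partial>M) * (\<integral>x. (g x)\<^sup>2 \<partial>M))"
    using f g by (simp add: ennreal_power nn_integral_eq_integral ennreal_mult)
  finally have "(\<integral>x. \<bar>f x * g x\<bar> \<partial>M)\<^sup>2 \<le> (\<integral>x. (f x)\<^sup>2 \<partial>M) * (\<integral>x. (g x)\<^sup>2 \<partial>M)"
    by (subst (asm) ennreal_le_iff) (auto intro!: mult_nonneg_nonneg)
  moreover have "(\<integral>x. f x * g x \<partial>M)\<^sup>2 \<le> (\<integral>x. \<bar>f x * g x\<bar> \<partial>M)\<^sup>2"
    using integral_abs_bound[of M "\<lambda>x. f x * g x"] by (intro abs_le_square_iff[THEN iffD1]) simp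
  ultimately show "(\<integral>x. f x * g x \<partial>M)\<^sup>2 \<le> (\<integral>x. (f x)\<^sup>2 \<partial>M) * (\<integral>x. (g x)\<^sup>2 \<partial>M)" by linarith
qed

context prob_space
begin

lemma integrable_square_add:
  fixes f g :: "'a \<Rightarrow> real"
  assumes "f \<in> borel_measurable M" "g \<in> borel_measurable M"
    and "integrable M (\<lambda>x. (f x)\<^sup>2)" "integrable M (\<lambda>x. (g x)\<^sup>2)"
  shows "integrable M (\<lambda>x. (f x + g x)\<^sup>2)" "integrable M (\<lambda>x. (f x - g x)\<^sup>2)"
  using integral_mult_square_le(1)[OF assms] assms(3,4)
  by (simp_all add: power2_sum power2_diff mult.assoc)

lemma var_nonneg:
  assumes "f \<in> borel_measurable M" "integrable M (\<lambda>x. (f x)\<^sup>2)"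
  shows "0 \<le> var M f"
  using variance_eq[OF square_integrable_imp_integrable[OF assms] assms(2)] variance_positive[of f]
  by (simp add: var_def)

text \<open>Parallelogram law for the variance, with Var(f - g) >= 0 dropped. This is the origin of
  the constant 2 in the final bound.\<close>

lemma var_add_le:
  assumes f: "f \<in> borel_measurable M" "integrable M (\<lambda>x. (f x)\<^sup>2)"
    and g: "g \<in> borel_measurable M" "integrable M (\<lambda>x. (g x)\<^sup>2)"
  shows "var M (\<lambda>x. f x + g x) \<le> 2 * (var M f + var M g)"
proof -
  note i = square_integrable_imp_integrable[OF f] square_integrable_imp_integrable[OF g]
    integral_mult_square_le(1)[OF f(1) g(1) f(2) g(2)] f(2) g(2)
  have "var M (\<lambda>x. f x + g x) + var M (\<lambda>x. f x - g x) = 2 * (var M f + var M g)"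
    unfolding var_def power2_sum power2_diff mult.assoc
    using i by (simp add: power2_sum power2_diff)
  moreover have "0 \<le> var M (\<lambda>x. f x - g x)"
    using f g by (intro var_nonneg integrable_square_add) auto
  ultimately show ?thesis by simp
qed

text \<open>Expanding u n around f leaves the squared error and its pairing with f; by
  Cauchy-Schwarz every pairing of the error with a fixed square integrable function tends to
  0.\<close>

lemma var_tendsto:
  assumes f: "f \<in> borel_measurable M" "integrable M (\<lambda>x. (f x)\<^sup>2)"
    and u: "\<And>n. u n \<in> borel_measurable M" "\<And>n. integrable M (\<lambda>x. (u n x)\<^sup>2)"
    and lim: "(\<lambda>n. \<integral>x. (f x - u n x)\<^sup>2 \<partial>M) \<longlonglongrightarrow> 0"
  shows "(\<lambda>n. var M (u n)) \<longlonglongrightarrow> var M f"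
proof -
  have d: "(\<lambda>x. f x - u n x) \<in> borel_measurable M" "integrable M (\<lambda>x. (f x - u n x)\<^sup>2)" for n
    using f u by (auto intro: integrable_square_add)
  have inner_lim: "(\<lambda>n. \<integral>x. (f x - u n x) * g x \<partial>M) \<longlonglongrightarrow> 0"
    if g: "g \<in> borel_measurable M" "integrable M (\<lambda>x. (g x)\<^sup>2)" for g
  proof -
    have "(\<lambda>n. (\<integral>x. (f x - u n x) * g x \<partial>M)\<^sup>2) \<longlonglongrightarrow> 0"
    proof (rule tendsto_sandwich[OF _ _ tendsto_const])
      show "\<forall>\<^sub>F n in sequentially. (\<integral>x. (f x - u n x) * g x \<partial>M)\<^sup>2 \<le> (\<integral>x. (f x - u n x)\<^sup>2 \<partial>M) * (\<integral>x. (g x)\<^sup>2 \<partial>M)"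
        by (intro always_eventually allI integral_mult_square_le(2) d g)
      show "(\<lambda>n. (\<integral>x. (f x - u n x)\<^sup>2 \<partial>M) * (\<integral>x. (g x)\<^sup>2 \<partial>M)) \<longlonglongrightarrow> 0"
        by (rule tendsto_mult_left_zero[OF lim])
    qed simp
    then have "(\<lambda>n. sqrt ((\<integral>x. (f x - u n x) * g x \<partial>M)\<^sup>2)) \<longlonglongrightarrow> sqrt 0"
      by (rule tendsto_real_sqrt)
    then show ?thesis by (simp add: tendsto_rabs_zero_iff)
  qed
  have eq: "(\<integral>x. (u n x)\<^sup>2 \<partial>M) = (\<integral>x. (f x - u n x)\<^sup>2 \<partial>M) - 2 * (\<integral>x. (f x - u n x) * f x \<partial>M) + (\<integral>x. (f x)\<^sup>2 \<partial>M)" for n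
  proof -
    have "(\<integral>x. (u n x)\<^sup>2 \<partial>M) = (\<integral>x. (f x - u n x)\<^sup>2 - 2 * ((f x - u n x) * f x) + (f x)\<^sup>2 \<partial>M)"
      by (rule Bochner_Integration.integral_cong) (auto simp: power2_eq_square algebra_simps)
    then show ?thesis using d f integral_mult_square_le(1)[OF d(1) f(1) d(2) f(2)] by simp
  qed
  \<comment> \<open>The factor 1 writes the error of the mean as one more pairing, so
    \<open>inner_lim\<close> covers it.\<close>
  have eq1: "(\<integral>x. u n x \<partial>M) = (\<integral>x. f x \<partial>M) - (\<integral>x. (f x - u n x) * 1 \<partial>M)" for n
    using square_integrable_imp_integrable[OF f] square_integrable_imp_integrable[OF u(1) u(2), of n] by simp
  have "(\<lambda>n. (\<integral>x. (u n x)\<^sup>2 \<partial>M) - (\<integral>x. u n x \<partial>M)\<^sup>2) \<longlonglongrightarrow>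
     (0 - 2 * 0 + (\<integral>x. (f x)\<^sup>2 \<partial>M)) - ((\<integral>x. f x \<partial>M) - 0)\<^sup>2"
    unfolding eq eq1 by (intro tendsto_intros lim inner_lim f) auto
  then show ?thesis by (simp add: var_def)
qed

end

section \<open>Gaussian integrals of trigonometric polynomials\<close>

lemma std_normal_cos_sin:
  "(\<integral>x. cos (t * x) \<partial>density lborel std_normal_density) = exp (- t\<^sup>2 / 2)"
  "(\<integral>x. sin (t * x) \<partial>density lborel std_normal_density) = 0"
proof -
  interpret prob_space "density lborel std_normal_density"
    by (rule prob_space_normal_density) simp
  have int: "integrable (density lborel std_normal_density) (\<lambda>x. iexp (t * x))"
    by (rule integrable_const_bound[where B=1]) auto
  have ch: "(CLINT x|density lborel std_normal_density. iexp (t * x)) = complex_of_real (exp (- (t^2) / 2))"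
    using char_std_normal_distribution by (simp add: char_def fun_eq_iff)
  show "(\<integral>x. cos (t * x) \<partial>density lborel std_normal_density) = exp (- t\<^sup>2 / 2)"
    using integral_Re[OF int] unfolding ch by (simp add: Re_exp)
  show "(\<integral>x. sin (t * x) \<partial>density lborel std_normal_density) = 0"
    using integral_Im[OF int] unfolding ch by (simp add: Im_exp)
qed

locale gaussian_measure =
  fixes M :: "(real ^ 'k::finite) measure"
  assumes gaussian: "centered_gaussian M"

sublocale gaussian_measure \<subseteq> prob_space M
  using gaussian by (simp add: centered_gaussian_def)

context gaussian_measure
begin

definition cov :: "real ^ 'k \<Rightarrow> real ^ 'k \<Rightarrow> real" where
  "cov u v = u \<bullet> (second_moment M *v v)"

lemma sets_M: "sets M = sets borel"
  using gaussian by (simp add: centered_gaussian_def)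

lemma measurable_M: "f \<in> borel_measurable borel \<Longrightarrow> f \<in> borel_measurable M"
  using measurable_cong_sets[OF sets_M refl] by blast

text \<open>All four facts are read off from one image law: u . x is distributed as \<sigma> times a
  variable whose trigonometric and second moments are known.\<close>

lemma inner_law:
  fixes u :: "real ^ 'k"
  obtains \<sigma> where "(\<integral>x. cos (u \<bullet> x) \<partial>M) = exp (- \<sigma>\<^sup>2 / 2)" "(\<integral>x. sin (u \<bullet> x) \<partial>M) = 0"
    "integrable M (\<lambda>x. (u \<bullet> x)\<^sup>2)" "(\<integral>x. (u \<bullet> x)\<^sup>2 \<partial>M) = \<sigma>\<^sup>2"
proof -
  obtain \<sigma> where \<sigma>: "\<sigma> \<ge> 0" and D: "distr M borel (\<lambda>x. u \<bullet> x) =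
        (if \<sigma> = 0 then return borel 0 else density lborel (normal_density 0 \<sigma>))"
    using gaussian unfolding centered_gaussian_def by blast
  have m: "(\<lambda>x. u \<bullet> x) \<in> borel_measurable M" by (rule measurable_M) measurable
  \<comment> \<open>N is the standard normal law if \<sigma> > 0 and the point mass at 0 if \<sigma>
    = 0, so degenerate directions obey the same formulas.\<close>
  obtain N :: "real measure" where N: "prob_space N" "sets N = sets borel"
    "distr M borel (\<lambda>x. u \<bullet> x) = distr N borel (\<lambda>y. \<sigma> * y)"
    "(\<integral>y. cos (\<sigma> * y) \<partial>N) = exp (- \<sigma>\<^sup>2 / 2)" "(\<integral>y. sin (\<sigma> * y) \<partial>N) = 0"
    "integrable N (\<lambda>y. (\<sigma> * y)\<^sup>2)" "(\<integral>y. (\<sigma> * y)\<^sup>2 \<partial>N) = \<sigma>\<^sup>2"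
  proof (cases "\<sigma> = 0")
    case True
    show ?thesis
    proof (rule that[of "return borel 0"])
      show "prob_space (return borel (0::real))" by (rule prob_space_return) simp
      have "distr (return borel (0::real)) borel (\<lambda>y. \<sigma> * y) = return borel (\<sigma> * 0)"
        by (rule distr_return) auto
      then show "distr M borel (\<lambda>x. u \<bullet> x) = distr (return borel 0) borel (\<lambda>y. \<sigma> * y)"
        using D True by simp
    qed (simp_all add: True integral_return measure_def)
  next
    case False
    then have pos: "\<sigma> > 0" using \<sigma> by simp
    have "distributed M lborel (\<lambda>x. u \<bullet> x) (normal_density 0 \<sigma>)"
      unfolding distributed_def using D False m by (auto simp: cong: distr_cong)
    then have std: "distributed M lborel (\<lambda>x. (u \<bullet> x) / \<sigma>) std_normal_density"
      using normal_standard_normal_convert[OF pos, of "\<lambda>x. u \<bullet> x" 0] by simp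
    let ?N = "density lborel std_normal_density"
    have m': "(\<lambda>x. (u \<bullet> x) / \<sigma>) \<in> borel_measurable M" using m by measurable
    have "distr M borel (\<lambda>x. (u \<bullet> x) / \<sigma>) = ?N"
      using std unfolding distributed_def by (auto cong: distr_cong)
    then have "distr ?N borel (\<lambda>y. \<sigma> * y) = distr (distr M borel (\<lambda>x. (u \<bullet> x) / \<sigma>)) borel (\<lambda>y. \<sigma> * y)"
      by simp
    also have "\<dots> = distr M borel ((\<lambda>y. \<sigma> * y) \<circ> (\<lambda>x. (u \<bullet> x) / \<sigma>))"
      by (rule distr_distr) (use m' in auto)
    also have "\<dots> = distr M borel (\<lambda>x. u \<bullet> x)" using pos by (simp add: o_def)
    finally have eq: "distr M borel (\<lambda>x. u \<bullet> x) = distr ?N borel (\<lambda>y. \<sigma> * y)" ..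
    show ?thesis
    proof (rule that[OF _ _ eq])
      show "prob_space ?N" by (rule prob_space_normal_density) simp
      show "integrable ?N (\<lambda>y. (\<sigma> * y)\<^sup>2)"
        using integrable_std_normal_distribution_moment[of 2] by (simp add: power_mult_distrib)
      show "(\<integral>y. (\<sigma> * y)\<^sup>2 \<partial>?N) = \<sigma>\<^sup>2"
        using std_normal_distribution_even_moments(1)[of 1] by (simp add: power_mult_distrib)
    qed (simp_all add: std_normal_cos_sin)
  qed
  have mN: "(\<lambda>y. \<sigma> * y) \<in> borel_measurable N"
    by (subst measurable_cong_sets[OF N(2) refl]) measurable
  have tr: "(\<integral>x. g (u \<bullet> x) \<partial>M) = (\<integral>y. g (\<sigma> * y) \<partial>N)" if "g \<in> borel_measurable borel" for g :: "real \<Rightarrow> real"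
    using integral_distr[OF m that] integral_distr[OF mN that] N(3) by simp
  have tri: "integrable M (\<lambda>x. g (u \<bullet> x)) \<longleftrightarrow> integrable N (\<lambda>y. g (\<sigma> * y))"
    if "g \<in> borel_measurable borel" for g :: "real \<Rightarrow> real"
    using integrable_distr_eq[OF m that] integrable_distr_eq[OF mN that] N(3) by simp
  show ?thesis
    using tr[of cos] tr[of sin] tr[of "\<lambda>t. t\<^sup>2"] tri[of "\<lambda>t. t\<^sup>2"] N
    by (intro that[of \<sigma>]) auto
qed

lemma integrable_inner_square: "integrable M (\<lambda>x. (u \<bullet> x)\<^sup>2)"
  using inner_law[of u] by metis

lemma integrable_coordinates: "integrable M (\<lambda>x. x $ i * x $ j)"
proof -
  have m: "(\<lambda>x. x $ i) \<in> borel_measurable M" for i by (rule measurable_M) measurable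
  have sq: "integrable M (\<lambda>x. (x $ i)\<^sup>2)" for i
    using integrable_inner_square[of "axis i 1"] by (simp add: inner_axis')
  show ?thesis by (rule integral_mult_square_le(1)[OF m m sq sq])
qed

lemma transpose_second_moment: "transpose (second_moment M) = second_moment M"
  by (simp add: transpose_def second_moment_def mult.commute)

lemma cov_sum: "cov u v = (\<Sum>i\<in>UNIV. \<Sum>j\<in>UNIV. u $ i * v $ j * (\<integral>x. x $ i * x $ j \<partial>M))"
  by (simp add: cov_def inner_vec_def matrix_vector_mult_def second_moment_def sum_distrib_left mult_ac)

lemma cov_eq_integral: "cov u u = (\<integral>x. (u \<bullet> x)\<^sup>2 \<partial>M)"
proof -
  have "(\<integral>x. (u \<bullet> x)\<^sup>2 \<partial>M) = (\<integral>x. (\<Sum>i\<in>UNIV. \<Sum>j\<in>UNIV. u $ i * u $ j * (x $ i * x $ j)) \<partial>M)"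
    by (simp add: inner_vec_def power2_eq_square sum_product mult_ac)
  also have "\<dots> = (\<Sum>i\<in>UNIV. \<Sum>j\<in>UNIV. u $ i * u $ j * (\<integral>x. x $ i * x $ j \<partial>M))"
    by (simp add: Bochner_Integration.integral_sum integrable_coordinates)
  finally show ?thesis by (simp add: cov_sum)
qed

lemma psd_form_cov: "psd_form cov"
proof -
  have "psd_form (\<lambda>x y. x \<bullet> (second_moment M *v y))"
    by (rule psd_form_matrix[OF transpose_second_moment])
      (use cov_eq_integral in \<open>simp add: cov_def\<close>)
  then show ?thesis by (simp add: cov_def[abs_def])
qed

lemma integral_cos: "(\<integral>x. cos (u \<bullet> x) \<partial>M) = exp (- cov u u / 2)"
  and integral_sin: "(\<integral>x. sin (u \<bullet> x) \<partial>M) = 0"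
proof -
  obtain \<sigma> where "(\<integral>x. cos (u \<bullet> x) \<partial>M) = exp (- \<sigma>\<^sup>2 / 2)" and s: "(\<integral>x. sin (u \<bullet> x) \<partial>M) = 0"
    "(\<integral>x. (u \<bullet> x)\<^sup>2 \<partial>M) = \<sigma>\<^sup>2" by (rule inner_law)
  then show "(\<integral>x. cos (u \<bullet> x) \<partial>M) = exp (- cov u u / 2)" by (simp add: cov_eq_integral)
  show "(\<integral>x. sin (u \<bullet> x) \<partial>M) = 0" by (rule s(1))
qed

lemma integrable_trig_poly: "trig_poly f \<Longrightarrow> integrable M f"
  using trig_poly_bounded[of f] trig_poly_measurable[OF sets_M]
  by (metis (mono_tags, lifting) AE_I2 integrable_const_bound real_norm_def)

lemma cov_add_add: "cov (u + v) (u + v) = cov u u + cov v v + 2 * cov u v"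
  and cov_diff_diff: "cov (u - v) (u - v) = cov u u + cov v v - 2 * cov u v"
proof -
  interpret psd_form cov by (rule psd_form_cov)
  show "cov (u + v) (u + v) = cov u u + cov v v + 2 * cov u v"
    using sym[of v u] by (simp add: bilinear_ladd[OF bilin] bilinear_radd[OF bilin])
  show "cov (u - v) (u - v) = cov u u + cov v v - 2 * cov u v"
    using sym[of v u] by (simp add: bilinear_lsub[OF bilin] bilinear_rsub[OF bilin])
qed

text \<open>Product-to-sum leads to the frequencies u - v and u + v, whose variances differ only in
  the sign of 2 \<open>cov u v\<close>; the half sum or half difference of the exponentials is cosh
  or sinh. Mixed products integrate to 0, so the cosine and sine parts decouple.\<close>

lemma integral_trig_products:
  "(\<integral>x. cos (u \<bullet> x) * cos (v \<bullet> x) \<partial>M) = exp (- cov u u / 2) * exp (- cov v v / 2) * cosh (cov u v)"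
  "(\<integral>x. sin (u \<bullet> x) * sin (v \<bullet> x) \<partial>M) = exp (- cov u u / 2) * exp (- cov v v / 2) * sinh (cov u v)"
  "(\<integral>x. sin (u \<bullet> x) * cos (v \<bullet> x) \<partial>M) = 0"
proof -
  have i: "integrable M (\<lambda>x. cos (w \<bullet> x))" "integrable M (\<lambda>x. sin (w \<bullet> x))" for w :: "real ^ 'k"
    by (intro integrable_trig_poly trig_poly.intros)+
  show "(\<integral>x. cos (u \<bullet> x) * cos (v \<bullet> x) \<partial>M) = exp (- cov u u / 2) * exp (- cov v v / 2) * cosh (cov u v)"
  proof -
    have "(\<integral>x. cos (u \<bullet> x) * cos (v \<bullet> x) \<partial>M) = (\<integral>x. (cos ((u - v) \<bullet> x) + cos ((u + v) \<bullet> x)) / 2 \<partial>M)"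
      by (simp add: cos_times_cos inner_diff_left inner_add_left)
    also have "\<dots> = (exp (- cov (u - v) (u - v) / 2) + exp (- cov (u + v) (u + v) / 2)) / 2"
      by (simp add: i integral_cos)
    also have "\<dots> = exp (- cov u u / 2) * exp (- cov v v / 2) * cosh (cov u v)"
      unfolding cov_add_add cov_diff_diff cosh_def
      by (simp add: exp_add[symmetric] algebra_simps add_divide_distrib diff_divide_distrib)
    finally show ?thesis .
  qed
  show "(\<integral>x. sin (u \<bullet> x) * sin (v \<bullet> x) \<partial>M) = exp (- cov u u / 2) * exp (- cov v v / 2) * sinh (cov u v)"
  proof -
    have "(\<integral>x. sin (u \<bullet> x) * sin (v \<bullet> x) \<partial>M) = (\<integral>x. (cos ((u - v) \<bullet> x) - cos ((u + v) \<bullet> x)) / 2 \<partial>M)"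
      by (simp add: sin_times_sin inner_diff_left inner_add_left)
    also have "\<dots> = (exp (- cov (u - v) (u - v) / 2) - exp (- cov (u + v) (u + v) / 2)) / 2"
      by (simp add: i integral_cos)
    also have "\<dots> = exp (- cov u u / 2) * exp (- cov v v / 2) * sinh (cov u v)"
      unfolding cov_add_add cov_diff_diff sinh_def
      by (simp add: exp_add[symmetric] algebra_simps add_divide_distrib diff_divide_distrib)
    finally show ?thesis .
  qed
  have "(\<integral>x. sin (u \<bullet> x) * cos (v \<bullet> x) \<partial>M) = (\<integral>x. (sin ((u + v) \<bullet> x) + sin ((u - v) \<bullet> x)) / 2 \<partial>M)"
    by (simp add: sin_times_cos inner_diff_left inner_add_left)
  also have "\<dots> = 0" by (simp add: i integral_sin)
  finally show "(\<integral>x. sin (u \<bullet> x) * cos (v \<bullet> x) \<partial>M) = 0" .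
qed

end

text \<open>Indexed by J with a frequency map w that need not be injective: both blocks may contain
  the frequency 0, and their constant terms must remain separate for the index sets to be
  disjoint.\<close>

definition trig_sum :: "('i \<Rightarrow> 'a) \<Rightarrow> ('i \<Rightarrow> real) \<Rightarrow> ('i \<Rightarrow> real) \<Rightarrow> 'i set \<Rightarrow> 'a::euclidean_space \<Rightarrow> real" where
  "trig_sum w a b J x = (\<Sum>j\<in>J. a j * cos (w j \<bullet> x) + b j * sin (w j \<bullet> x))"

lemma trig_poly_imp_trig_sum:
  assumes "trig_poly f"
  obtains W a b where "finite W" "f = trig_sum (\<lambda>w. w) a b W"
proof -
  have "\<exists>W a b. finite W \<and> (\<forall>x. f x = trig_sum (\<lambda>w. w) a b W x)"
    using assms
  proof induction
    case (cos w)
    show ?case by (intro exI[of _ "{w}"] exI[of _ "\<lambda>_. 1"] exI[of _ "\<lambda>_. 0"]) (simp add: trig_sum_def)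
  next
    case (sin w)
    show ?case by (intro exI[of _ "{w}"] exI[of _ "\<lambda>_. 0"] exI[of _ "\<lambda>_. 1"]) (simp add: trig_sum_def)
  next
    case (add f g)
    obtain W a b where f: "finite W" "\<And>x. f x = trig_sum (\<lambda>w. w) a b W x" using add.IH(1) by blast
    obtain V c d where g: "finite V" "\<And>x. g x = trig_sum (\<lambda>w. w) c d V x" using add.IH(2) by blast
    \<comment> \<open>Extension of coefficients by 0, to bring both sums to the common index
      set.\<close>
    define z where "z S a w = (if w \<in> S then a w else 0)" for S :: "'a set" and a :: "'a \<Rightarrow> real" and w
    have ext: "trig_sum (\<lambda>w. w) a b S x = trig_sum (\<lambda>w. w) (z S a) (z S b) T x"
      if "finite T" "S \<subseteq> T" for a b S T x
      unfolding trig_sum_def by (rule sum.mono_neutral_cong_left) (use that in \<open>auto simp: z_def\<close>)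
    have "f x + g x = trig_sum (\<lambda>w. w) (\<lambda>w. z W a w + z V c w) (\<lambda>w. z W b w + z V d w) (W \<union> V) x" for x
      unfolding f(2) g(2) ext[of "W \<union> V" W, OF finite_UnI[OF f(1) g(1)] Un_upper1]
        ext[of "W \<union> V" V, OF finite_UnI[OF f(1) g(1)] Un_upper2]
      by (simp add: trig_sum_def sum.distrib[symmetric] algebra_simps)
    then show ?case using f(1) g(1) by blast
  next
    case (scale f c)
    obtain W a b where f: "finite W" "\<And>x. f x = trig_sum (\<lambda>w. w) a b W x" using scale.IH by blast
    have "c * f x = trig_sum (\<lambda>w. w) (\<lambda>w. c * a w) (\<lambda>w. c * b w) W x" for x
      by (simp add: f(2) trig_sum_def sum_distrib_left algebra_simps)
    then show ?case using f(1) by blast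
  qed
  then show ?thesis using that by (metis ext)
qed

context gaussian_measure
begin

text \<open>The factors E depend on one frequency each and join the coefficients, so the remaining
  kernel depends on \<open>cov\<close> alone. The squared mean cancels exactly the constant term of
  cosh.\<close>

lemma var_trig_sum:
  assumes "finite J"
  defines "E \<equiv> \<lambda>w. exp (- cov w w / 2)"
  shows "var M (trig_sum w a b J) = (\<Sum>j\<in>J. \<Sum>k\<in>J.
     (a j * E (w j)) * (a k * E (w k)) * (cosh (cov (w j) (w k)) - 1) +
     (b j * E (w j)) * (b k * E (w k)) * sinh (cov (w j) (w k)))"
proof -
  have i: "integrable M (\<lambda>x. cos (u \<bullet> x))" "integrable M (\<lambda>x. sin (u \<bullet> x))" for u :: "real ^ 'k"
    by (intro integrable_trig_poly trig_poly.intros)+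
  have ip: "integrable M (\<lambda>x. cos (u \<bullet> x) * cos (v \<bullet> x))" "integrable M (\<lambda>x. sin (u \<bullet> x) * sin (v \<bullet> x))"
    "integrable M (\<lambda>x. sin (u \<bullet> x) * cos (v \<bullet> x))" for u v :: "real ^ 'k"
    by (intro integrable_trig_poly trig_poly_mult trig_poly.intros)+
  have mean: "(\<integral>x. trig_sum w a b J x \<partial>M) = (\<Sum>j\<in>J. a j * E (w j))"
    unfolding trig_sum_def by (simp add: i integral_cos integral_sin E_def)
  \<comment> \<open>The multiplied-out square, with sine before cosine in the mixed products, which
    integrate to 0.\<close>
  define T where "T j k x = a j * a k * (cos (w j \<bullet> x) * cos (w k \<bullet> x)) +
     b j * b k * (sin (w j \<bullet> x) * sin (w k \<bullet> x)) +
     (b j * a k) * (sin (w j \<bullet> x) * cos (w k \<bullet> x)) +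
     (b k * a j) * (sin (w k \<bullet> x) * cos (w j \<bullet> x))" for j k and x :: "real ^ 'k"
  have iT: "integrable M (T j k)" for j k
    unfolding T_def[abs_def] by (intro Bochner_Integration.integrable_add integrable_mult_right ip)
  have sq: "(trig_sum w a b J x)\<^sup>2 = (\<Sum>j\<in>J. \<Sum>k\<in>J. T j k x)" for x
    unfolding trig_sum_def power2_eq_square sum_product T_def
    by (intro sum.cong refl) (simp add: algebra_simps)
  have "(\<integral>x. T j k x \<partial>M) = a j * a k * (E (w j) * E (w k) * cosh (cov (w j) (w k))) +
     b j * b k * (E (w j) * E (w k) * sinh (cov (w j) (w k)))" for j k
    unfolding T_def by (simp add: ip integral_trig_products E_def)
  then have "(\<integral>x. (trig_sum w a b J x)\<^sup>2 \<partial>M) = (\<Sum>j\<in>J. \<Sum>k\<in>J.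
    a j * a k * (E (w j) * E (w k) * cosh (cov (w j) (w k))) +
     b j * b k * (E (w j) * E (w k) * sinh (cov (w j) (w k))))"
    unfolding sq by (simp add: iT)
  moreover have "(\<Sum>j\<in>J. a j * E (w j))\<^sup>2 = (\<Sum>j\<in>J. \<Sum>k\<in>J. (a j * E (w j)) * (a k * E (w k)))"
    by (simp add: power2_eq_square sum_product)
  ultimately show ?thesis
    unfolding var_def mean by (simp add: sum_subtractf[symmetric] algebra_simps)
qed

end

section \<open>Termwise comparison of the covariance kernel with the inner product\<close>

lemma double_sum_nonneg_of_sums:
  fixes f :: "nat \<Rightarrow> 'i \<Rightarrow> 'i \<Rightarrow> real"
  assumes "\<And>j k. j \<in> J \<Longrightarrow> k \<in> J \<Longrightarrow> (\<lambda>n. f n j k) sums g j k"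
    and "\<And>n. 0 \<le> (\<Sum>j\<in>J. \<Sum>k\<in>J. f n j k)"
  shows "0 \<le> (\<Sum>j\<in>J. \<Sum>k\<in>J. g j k)"
proof -
  have "(\<lambda>n. \<Sum>j\<in>J. \<Sum>k\<in>J. f n j k) sums (\<Sum>j\<in>J. \<Sum>k\<in>J. g j k)"
    by (intro sums_sum assms(1))
  then show ?thesis by (rule sums_le[OF _ sums_zero, rotated]) (rule assms(2))
qed

lemma cosh_minus_one_sums:
  "(\<lambda>n. if even n \<and> n \<noteq> 0 then x ^ n / fact n else 0) sums (cosh x - 1 :: real)"
proof -
  have "(\<lambda>n. (if even n then x ^ n /\<^sub>R fact n else 0) - (if n = 0 then 1 else 0)) sums (cosh x - 1)"
    by (intro sums_diff cosh_converges sums_single)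
  moreover have "(\<lambda>n. (if even n then x ^ n /\<^sub>R fact n else 0) - (if n = 0 then 1 else 0))
      = (\<lambda>n. if even n \<and> n \<noteq> 0 then x ^ n / fact n else 0)"
    by (auto simp: divide_inverse)
  ultimately show ?thesis by simp
qed

lemma psd_form_inner: "psd_form (inner :: 'a::euclidean_space \<Rightarrow> 'a \<Rightarrow> real)"
  by standard (auto simp: bilinear_def linear_iff inner_add_left inner_add_right inner_commute)

text \<open>To be instantiated with the covariance form, its smallest eigenvalue, and the
  frequencies supported in the first and in the second block; \<open>block1\<close> and
  \<open>block2\<close> express the identity second moments.\<close>

locale block_form = psd_form A for A :: "'a::euclidean_space \<Rightarrow> 'a \<Rightarrow> real" +
  fixes l :: real and V1 V2 :: "'a set"
  assumes l: "0 \<le> l" "l \<le> 1"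
    and lower: "l * (x \<bullet> x) \<le> A x x"
    and block1: "x \<in> V1 \<Longrightarrow> y \<in> V1 \<Longrightarrow> A x y = x \<bullet> y"
    and block2: "x \<in> V2 \<Longrightarrow> y \<in> V2 \<Longrightarrow> A x y = x \<bullet> y"
    and cross: "x \<in> V1 \<Longrightarrow> y \<in> V2 \<Longrightarrow> x \<bullet> y = 0"
begin

text \<open>On each block \<open>A\<close> is the inner product, and across blocks the inner product vanishes, so
  with \<open>r = 1 - l\<close> the kernel \<open>A ^ n - l * inner ^ n\<close> is
  \<open>(A - l * inner) ^ n + (r - r ^ n) * inner ^ n\<close>: a combination of powers of positive
  semidefinite forms with nonnegative coefficients.\<close>
lemma power_nonneg:
  assumes J: "finite J" "\<And>j. j \<in> J \<Longrightarrow> w j \<in> V1 \<union> V2" and n: "n \<noteq> 0"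
  shows "0 \<le> (\<Sum>j\<in>J. \<Sum>k\<in>J. \<alpha> j * \<alpha> k * (A (w j) (w k) ^ n - l * (w j \<bullet> w k) ^ n))"
proof -
  define D where "D x y = A x y - l * (x \<bullet> y)" for x y
  define r where "r = 1 - l"
  have psd: "psd_form D"
  proof
    have lin: "linear (\<lambda>x. A x y)" "linear (A x)" for x y using bilin by (auto simp: bilinear_def)
    have "linear (\<lambda>y. A x y - l * (x \<bullet> y))" for x
      using lin(2)[of x] by (auto simp: linear_iff inner_add_right algebra_simps)
    moreover have "linear (\<lambda>x. A x y - l * (x \<bullet> y))" for y
      using lin(1)[of y] by (auto simp: linear_iff inner_add_left algebra_simps)
    ultimately show "bilinear D" unfolding bilinear_def D_def by simp
    show "D x y = D y x" for x y using sym[of x y] by (simp add: D_def inner_commute)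
    show "0 \<le> D x x" for x using lower[of x] by (simp add: D_def)
  qed
  have eq: "A (w j) (w k) ^ n - l * (w j \<bullet> w k) ^ n = D (w j) (w k) ^ n + (r - r ^ n) * (w j \<bullet> w k) ^ n"
    if jk: "j \<in> J" "k \<in> J" for j k
  proof -
    have "A (w j) (w k) = w j \<bullet> w k \<or> w j \<bullet> w k = 0"
      using J(2)[OF jk(1)] J(2)[OF jk(2)] block1 block2 cross[of "w j" "w k"] cross[of "w k" "w j"]
      by (auto simp: inner_commute)
    then show ?thesis
    proof
      \<comment> \<open>Here D is r times the inner product, so D^n carries r^n and the correction r
        - r^n restores the total coefficient r = 1 - l.\<close>
      assume "A (w j) (w k) = w j \<bullet> w k"
      then have "D (w j) (w k) = r * (w j \<bullet> w k)" "A (w j) (w k) = w j \<bullet> w k"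
        by (simp_all add: D_def r_def left_diff_distrib)
      then show ?thesis by (simp add: power_mult_distrib algebra_simps) (simp add: r_def algebra_simps)
    next
      assume "w j \<bullet> w k = 0"
      then show ?thesis using n by (simp add: D_def power_0_left)
    qed
  qed
  \<comment> \<open>As 0 <= r <= 1 and n >= 1, the coefficient r - r^n is nonnegative.\<close>
  have "r ^ n \<le> r ^ 1" using l n by (intro power_decreasing) (auto simp: r_def)
  then have "0 \<le> (\<Sum>j\<in>J. \<Sum>k\<in>J. \<alpha> j * \<alpha> k * D (w j) (w k) ^ n) +
      (r - r ^ n) * (\<Sum>j\<in>J. \<Sum>k\<in>J. \<alpha> j * \<alpha> k * (w j \<bullet> w k) ^ n)"
    by (intro add_nonneg_nonneg mult_nonneg_nonneg psd_form_power[OF psd J(1)]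
        psd_form_power[OF psd_form_inner J(1)]) simp
  also have "\<dots> = (\<Sum>j\<in>J. \<Sum>k\<in>J. \<alpha> j * \<alpha> k * (A (w j) (w k) ^ n - l * (w j \<bullet> w k) ^ n))"
    unfolding sum_distrib_left sum.distrib[symmetric]
    by (intro sum.cong refl) (simp add: eq algebra_simps)
  finally show ?thesis .
qed

lemma cosh_nonneg:
  assumes J: "finite J" "\<And>j. j \<in> J \<Longrightarrow> w j \<in> V1 \<union> V2"
  shows "0 \<le> (\<Sum>j\<in>J. \<Sum>k\<in>J. \<alpha> j * \<alpha> k * ((cosh (A (w j) (w k)) - 1) - l * (cosh (w j \<bullet> w k) - 1)))"
proof (rule double_sum_nonneg_of_sums)
  fix j k
  show "(\<lambda>n. \<alpha> j * \<alpha> k * ((if even n \<and> n \<noteq> 0 then A (w j) (w k) ^ n / fact n else 0)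
      - l * (if even n \<and> n \<noteq> 0 then (w j \<bullet> w k) ^ n / fact n else 0))) sums
    (\<alpha> j * \<alpha> k * ((cosh (A (w j) (w k)) - 1) - l * (cosh (w j \<bullet> w k) - 1)))"
    by (intro sums_mult sums_diff cosh_minus_one_sums)
next
  fix n
  show "0 \<le> (\<Sum>j\<in>J. \<Sum>k\<in>J. \<alpha> j * \<alpha> k * ((if even n \<and> n \<noteq> 0 then A (w j) (w k) ^ n / fact n else 0)
      - l * (if even n \<and> n \<noteq> 0 then (w j \<bullet> w k) ^ n / fact n else 0)))"
  proof (cases "even n \<and> n \<noteq> 0")
    case True
    then have "(\<Sum>j\<in>J. \<Sum>k\<in>J. \<alpha> j * \<alpha> k * ((if even n \<and> n \<noteq> 0 then A (w j) (w k) ^ n / fact n else 0)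
      - l * (if even n \<and> n \<noteq> 0 then (w j \<bullet> w k) ^ n / fact n else 0))) =
      (\<Sum>j\<in>J. \<Sum>k\<in>J. \<alpha> j * \<alpha> k * (A (w j) (w k) ^ n - l * (w j \<bullet> w k) ^ n)) / fact n"
      unfolding sum_divide_distrib by (intro sum.cong refl) (simp add: field_simps)
    then show ?thesis using power_nonneg[of J w n \<alpha>] J True by simp
  qed (auto simp only: if_False simp_thms mult_zero_right diff_self sum.neutral_const)
qed

lemma sinh_nonneg:
  assumes J: "finite J" "\<And>j. j \<in> J \<Longrightarrow> w j \<in> V1 \<union> V2"
  shows "0 \<le> (\<Sum>j\<in>J. \<Sum>k\<in>J. \<alpha> j * \<alpha> k * (sinh (A (w j) (w k)) - l * sinh (w j \<bullet> w k)))"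
proof (rule double_sum_nonneg_of_sums)
  fix j k
  show "(\<lambda>n. \<alpha> j * \<alpha> k * ((if even n then 0 else A (w j) (w k) ^ n /\<^sub>R fact n)
      - l * (if even n then 0 else (w j \<bullet> w k) ^ n /\<^sub>R fact n))) sums
    (\<alpha> j * \<alpha> k * (sinh (A (w j) (w k)) - l * sinh (w j \<bullet> w k)))"
    by (intro sums_mult sums_diff sinh_converges)
next
  fix n
  show "0 \<le> (\<Sum>j\<in>J. \<Sum>k\<in>J. \<alpha> j * \<alpha> k * ((if even n then 0 else A (w j) (w k) ^ n /\<^sub>R fact n)
      - l * (if even n then 0 else (w j \<bullet> w k) ^ n /\<^sub>R fact n)))"
  proof (cases "even n")
    case False
    then have "(\<Sum>j\<in>J. \<Sum>k\<in>J. \<alpha> j * \<alpha> k * ((if even n then 0 else A (w j) (w k) ^ n /\<^sub>R fact n)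
      - l * (if even n then 0 else (w j \<bullet> w k) ^ n /\<^sub>R fact n))) =
      (\<Sum>j\<in>J. \<Sum>k\<in>J. \<alpha> j * \<alpha> k * (A (w j) (w k) ^ n - l * (w j \<bullet> w k) ^ n)) / fact n"
      unfolding sum_divide_distrib by (intro sum.cong refl) (simp add: field_simps)
    moreover have "n \<noteq> 0" using False by (auto intro: ccontr)
    ultimately show ?thesis using power_nonneg[of J w n \<alpha>] J by simp
  qed simp
qed

end

text \<open>The two block variances add up to one quadratic form K over the union, the variance
  formula with \<open>cov\<close> replaced by the inner product: inside a block the two agree, and
  across blocks K vanishes since cosh 0 - 1 = sinh 0 = 0. Both sides then have the same
  coefficients, and only the kernels are compared.\<close>

lemma (in gaussian_measure) var_trig_sum_ge:
  assumes "block_form cov l V1 V2"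
    and J: "finite J1" "finite J2" "J1 \<inter> J2 = {}" "w ` J1 \<subseteq> V1" "w ` J2 \<subseteq> V2"
  shows "l * (var M (trig_sum w a b J1) + var M (trig_sum w a b J2)) \<le> var M (trig_sum w a b (J1 \<union> J2))"
proof -
  interpret block_form cov l V1 V2 by fact
  define \<alpha> \<beta> where "\<alpha> j = a j * exp (- cov (w j) (w j) / 2)" and "\<beta> j = b j * exp (- cov (w j) (w j) / 2)" for j
  define K where "K j k = \<alpha> j * \<alpha> k * (cosh (w j \<bullet> w k) - 1) + \<beta> j * \<beta> k * sinh (w j \<bullet> w k)" for j k
  let ?J = "J1 \<union> J2"
  have fin: "finite ?J" using J by simp
  have w: "w j \<in> V1 \<union> V2" if "j \<in> ?J" for j using J that by blast
  have zero: "K j k = 0" "K k j = 0" if "j \<in> J1" "k \<in> J2" for j k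
  proof -
    have "w j \<in> V1" "w k \<in> V2" using J(4,5) that by blast+
    then have "w j \<bullet> w k = 0" "w k \<bullet> w j = 0" using cross by (simp_all add: inner_commute)
    then show "K j k = 0" "K k j = 0" by (simp_all add: K_def)
  qed
  have v1: "var M (trig_sum w a b J1) = (\<Sum>j\<in>J1. \<Sum>k\<in>J1. K j k)"
    unfolding var_trig_sum[OF J(1)] K_def \<alpha>_def \<beta>_def
    by (intro sum.cong refl) (use J in \<open>simp add: block1 image_subset_iff\<close>)
  have v2: "var M (trig_sum w a b J2) = (\<Sum>j\<in>J2. \<Sum>k\<in>J2. K j k)"
    unfolding var_trig_sum[OF J(2)] K_def \<alpha>_def \<beta>_def
    by (intro sum.cong refl) (use J in \<open>simp add: block2 image_subset_iff\<close>)
  have "(\<Sum>j\<in>?J. \<Sum>k\<in>?J. K j k) = var M (trig_sum w a b J1) + var M (trig_sum w a b J2)"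
    unfolding v1 v2 using J zero by (simp add: sum.union_disjoint sum.distrib)
  moreover have "0 \<le> (\<Sum>j\<in>?J. \<Sum>k\<in>?J. \<alpha> j * \<alpha> k * ((cosh (cov (w j) (w k)) - 1) - l * (cosh (w j \<bullet> w k) - 1)))
     + (\<Sum>j\<in>?J. \<Sum>k\<in>?J. \<beta> j * \<beta> k * (sinh (cov (w j) (w k)) - l * sinh (w j \<bullet> w k)))"
    by (intro add_nonneg_nonneg cosh_nonneg sinh_nonneg fin w)
  moreover have "\<dots> = var M (trig_sum w a b ?J) - l * (\<Sum>j\<in>?J. \<Sum>k\<in>?J. K j k)"
    unfolding var_trig_sum[OF fin] sum_distrib_left sum.distrib[symmetric] sum_subtractf[symmetric]
    by (intro sum.cong refl) (simp add: K_def \<alpha>_def \<beta>_def algebra_simps)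
  ultimately show ?thesis by simp
qed

section \<open>Additive functions of a standardized Gaussian pair\<close>

lemma sum_over_sum_type:
  fixes f :: "'n::finite + 'm::finite \<Rightarrow> 'b::comm_monoid_add"
  shows "(\<Sum>s\<in>UNIV. f s) = (\<Sum>i\<in>UNIV. f (Inl i)) + (\<Sum>j\<in>UNIV. f (Inr j))"
  using sum.Plus[of UNIV UNIV f] by (simp add: UNIV_Plus_UNIV)

text \<open>Extension by zero, the adjoint of \<open>part1\<close>: a wave in the first block with
  frequency u is a wave on the whole space with frequency \<open>emb1 u\<close>.\<close>

definition emb1 :: "real ^ 'n \<Rightarrow> real ^ ('n::finite + 'm::finite)" where
  "emb1 u = (\<chi> s. case s of Inl i \<Rightarrow> u $ i | Inr _ \<Rightarrow> 0)"

definition emb2 :: "real ^ 'm \<Rightarrow> real ^ ('n::finite + 'm::finite)" where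
  "emb2 v = (\<chi> s. case s of Inl _ \<Rightarrow> 0 | Inr j \<Rightarrow> v $ j)"

lemma emb_inner: "emb1 u \<bullet> x = u \<bullet> part1 x" "emb2 v \<bullet> x = v \<bullet> part2 x"
  by (simp_all add: inner_vec_def sum_over_sum_type emb1_def emb2_def part1_def part2_def)

lemma part_measurable:
  assumes "sets M = sets (borel :: (real ^ ('n::finite + 'm::finite)) measure)"
  shows "(part1 :: _ \<Rightarrow> real ^ 'n) \<in> borel_measurable M" "(part2 :: _ \<Rightarrow> real ^ 'm) \<in> borel_measurable M"
proof -
  have c: "(\<lambda>x. x $ s) \<in> borel_measurable M" for s :: "'n + 'm"
    by (subst measurable_cong_sets[OF assms refl]) simp
  show "(part1 :: _ \<Rightarrow> real ^ 'n) \<in> borel_measurable M"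
  proof (subst borel_measurable_euclidean_space, rule ballI)
    fix e :: "real ^ 'n" assume "e \<in> Basis"
    then obtain i where "e = axis i 1" by (auto simp: Basis_vec_def)
    then have "(\<lambda>x :: real ^ ('n + 'm). part1 x \<bullet> e) = (\<lambda>x. x $ Inl i)"
      by (simp add: inner_axis part1_def)
    then show "(\<lambda>x :: real ^ ('n + 'm). part1 x \<bullet> e) \<in> borel_measurable M" using c by simp
  qed
  show "(part2 :: _ \<Rightarrow> real ^ 'm) \<in> borel_measurable M"
  proof (subst borel_measurable_euclidean_space, rule ballI)
    fix e :: "real ^ 'm" assume "e \<in> Basis"
    then obtain i where "e = axis i 1" by (auto simp: Basis_vec_def)
    then have "(\<lambda>x :: real ^ ('n + 'm). part2 x \<bullet> e) = (\<lambda>x. x $ Inr i)"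
      by (simp add: inner_axis part2_def)
    then show "(\<lambda>x :: real ^ ('n + 'm). part2 x \<bullet> e) \<in> borel_measurable M" using c by simp
  qed
qed

lemma inner_over_sum_type:
  fixes u v :: "real ^ ('n::finite + 'm::finite)"
  shows "u \<bullet> v = (\<Sum>i\<in>UNIV. u $ Inl i * v $ Inl i) + (\<Sum>j\<in>UNIV. u $ Inr j * v $ Inr j)"
  by (simp add: inner_vec_def sum_over_sum_type)

locale standardized_gaussian = gaussian_measure P
  for P :: "(real ^ ('n::finite + 'm::finite)) measure" +
  assumes moments1: "(\<integral>x. x $ Inl i * x $ Inl j \<partial>P) = (if i = j then 1 else 0)"
    and moments2: "(\<integral>x. x $ Inr i' * x $ Inr j' \<partial>P) = (if i' = j' then 1 else 0)"
begin

abbreviation "lam \<equiv> lambda_min (second_moment P)"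

text \<open>The Rayleigh bound at a coordinate vector of the first block, which has length 1 and, by
  the normalization, variance 1.\<close>

lemma lam_le_1: "lam \<le> 1"
proof -
  fix i :: 'n
  define e :: "real ^ ('n + 'm)" where "e = axis (Inl i) 1"
  have "lam * (e \<bullet> e) \<le> cov e e"
    unfolding cov_def by (rule lambda_min_le_rayleigh[OF transpose_second_moment])
  also have "cov e e = 1"
    using moments1[of i i] by (simp add: e_def cov_eq_integral inner_axis' power2_eq_square)
  finally show ?thesis by (simp add: e_def inner_axis)
qed

lemma block_form_cov:
  assumes "0 \<le> lam"
  shows "block_form cov lam (range emb1) (range emb2)"
proof -
  interpret psd_form cov by (rule psd_form_cov)
  show ?thesis
  proof
    show "0 \<le> lam" "lam \<le> 1" by (fact assms lam_le_1)+
    show "lam * (x \<bullet> x) \<le> cov x x" for x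
      unfolding cov_def by (rule lambda_min_le_rayleigh[OF transpose_second_moment])
    show "cov x y = x \<bullet> y" if "x \<in> range emb1" "y \<in> range emb1" for x y
      using that by (auto simp: cov_sum sum_over_sum_type emb1_def moments1 inner_over_sum_type
          if_distrib[of "(*) _"] cong: if_cong)
    show "cov x y = x \<bullet> y" if "x \<in> range emb2" "y \<in> range emb2" for x y
      using that by (auto simp: cov_sum sum_over_sum_type emb2_def moments2 inner_over_sum_type
          if_distrib[of "(*) _"] cong: if_cong)
    show "x \<bullet> y = 0" if "x \<in> range emb1" "y \<in> range emb2" for x y
      using that by (auto simp: emb1_def emb2_def inner_over_sum_type)
  qed
qed

lemmas part_meas = part_measurable[OF sets_M]

lemma trig_poly_part1: "trig_poly p \<Longrightarrow> trig_poly (\<lambda>x. p (part1 x))"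
  by (induction rule: trig_poly.induct) (simp_all only: emb_inner[symmetric] trig_poly.intros)

lemma trig_poly_part2: "trig_poly q \<Longrightarrow> trig_poly (\<lambda>x. q (part2 x))"
  by (induction rule: trig_poly.induct) (simp_all only: emb_inner[symmetric] trig_poly.intros)

lemma var_trig_poly_ge:
  assumes l: "0 \<le> lam" and p: "trig_poly p" "trig_poly q"
  shows "lam * (var P (\<lambda>x. p (part1 x)) + var P (\<lambda>x. q (part2 x))) \<le> var P (\<lambda>x. p (part1 x) + q (part2 x))"
proof -
  obtain W a b where W: "finite W" "p = trig_sum (\<lambda>w. w) a b W" by (rule trig_poly_imp_trig_sum[OF p(1)])
  obtain V c d where V: "finite V" "q = trig_sum (\<lambda>w. w) c d V" by (rule trig_poly_imp_trig_sum[OF p(2)])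
  let ?w = "case_sum emb1 emb2" and ?a = "case_sum a c" and ?b = "case_sum b d"
  have p1: "p (part1 x) = trig_sum ?w ?a ?b (Inl ` W) x" for x
    by (simp add: W(2) trig_sum_def sum.reindex emb_inner)
  have q1: "q (part2 x) = trig_sum ?w ?a ?b (Inr ` V) x" for x
    by (simp add: V(2) trig_sum_def sum.reindex emb_inner)
  have pq: "trig_sum ?w ?a ?b (Inl ` W) x + trig_sum ?w ?a ?b (Inr ` V) x
    = trig_sum ?w ?a ?b (Inl ` W \<union> Inr ` V) x" for x
    unfolding trig_sum_def by (rule sum.union_disjoint[symmetric]) (use W V in auto)
  show ?thesis
    unfolding p1 q1 pq
    by (rule var_trig_sum_ge[OF block_form_cov[OF l]])
      (use W V in auto)
qed

text \<open>Gebelein's inequality in variance form: it passes from trigonometric polynomials to all of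
  \<open>L\<^sup>2\<close> because the variance is continuous there.\<close>
lemma var_parts_ge:
  assumes l: "0 \<le> lam" and f: "f \<in> borel_measurable borel" "integrable P (\<lambda>x. (f (part1 x))\<^sup>2)"
    and g: "g \<in> borel_measurable borel" "integrable P (\<lambda>x. (g (part2 x))\<^sup>2)"
  shows "lam * (var P (\<lambda>x. f (part1 x)) + var P (\<lambda>x. g (part2 x))) \<le> var P (\<lambda>x. f (part1 x) + g (part2 x))"
proof -
  obtain p where p: "\<And>n::nat. trig_poly (p n)" "(\<lambda>n. \<integral>x. (f (part1 x) - p n (part1 x))\<^sup>2 \<partial>P) \<longlonglongrightarrow> 0"
    by (rule trig_poly_approx_seq[OF part_meas(1) f]) (rule that)
  obtain q where q: "\<And>n::nat. trig_poly (q n)" "(\<lambda>n. \<integral>x. (g (part2 x) - q n (part2 x))\<^sup>2 \<partial>P) \<longlonglongrightarrow> 0"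
    by (rule trig_poly_approx_seq[OF part_meas(2) g]) (rule that)
  have fm: "(\<lambda>x. f (part1 x)) \<in> borel_measurable P" by (rule measurable_compose[OF part_meas(1) f(1)])
  have gm: "(\<lambda>x. g (part2 x)) \<in> borel_measurable P" by (rule measurable_compose[OF part_meas(2) g(1)])
  have trig: "h \<in> borel_measurable P" "integrable P (\<lambda>x. (h x)\<^sup>2)" if "trig_poly h" for h
    using trig_poly_measurable[OF sets_M that] integrable_trig_poly[OF trig_poly_mult[OF that that]]
    by (simp_all add: power2_eq_square)
  note tp = trig_poly_part1[OF p(1)] and tq = trig_poly_part2[OF q(1)]
  note tpq = trig_poly.add[OF tp tq]
  note df = integrable_square_add(2)[OF fm trig(1)[OF tp] f(2) trig(2)[OF tp]]
  note dg = integrable_square_add(2)[OF gm trig(1)[OF tq] g(2) trig(2)[OF tq]]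
  have mf: "(\<lambda>x. f (part1 x) - p n (part1 x)) \<in> borel_measurable P" for n
    using fm trig(1)[OF tp] by (rule borel_measurable_diff)
  have mg: "(\<lambda>x. g (part2 x) - q n (part2 x)) \<in> borel_measurable P" for n
    using gm trig(1)[OF tq] by (rule borel_measurable_diff)
  have sum_lim: "(\<lambda>n. \<integral>x. ((f (part1 x) + g (part2 x)) - (p n (part1 x) + q n (part2 x)))\<^sup>2 \<partial>P) \<longlonglongrightarrow> 0"
  proof (rule tendsto_sandwich[OF _ _ tendsto_const])
    have "(\<integral>x. ((f (part1 x) + g (part2 x)) - (p n (part1 x) + q n (part2 x)))\<^sup>2 \<partial>P)
      \<le> (\<integral>x. 2 * (f (part1 x) - p n (part1 x))\<^sup>2 + 2 * (g (part2 x) - q n (part2 x))\<^sup>2 \<partial>P)" for n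
    proof (rule integral_mono)
      show "integrable P (\<lambda>x. ((f (part1 x) + g (part2 x)) - (p n (part1 x) + q n (part2 x)))\<^sup>2)"
        using integrable_square_add(1)[OF mf mg df dg, of n n] by (simp only: add_diff_add)
      show "integrable P (\<lambda>x. 2 * (f (part1 x) - p n (part1 x))\<^sup>2 + 2 * (g (part2 x) - q n (part2 x))\<^sup>2)"
        using df dg by simp
      fix x
      show "((f (part1 x) + g (part2 x)) - (p n (part1 x) + q n (part2 x)))\<^sup>2
        \<le> 2 * (f (part1 x) - p n (part1 x))\<^sup>2 + 2 * (g (part2 x) - q n (part2 x))\<^sup>2"
        unfolding add_diff_add by (rule power2_add_le)
    qed
    then show "\<forall>\<^sub>F n in sequentially. (\<integral>x. ((f (part1 x) + g (part2 x)) - (p n (part1 x) + q n (part2 x)))\<^sup>2 \<partial>P)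
      \<le> 2 * (\<integral>x. (f (part1 x) - p n (part1 x))\<^sup>2 \<partial>P) + 2 * (\<integral>x. (g (part2 x) - q n (part2 x))\<^sup>2 \<partial>P)"
      using df dg by simp
    have "(\<lambda>n. 2 * (\<integral>x. (f (part1 x) - p n (part1 x))\<^sup>2 \<partial>P) + 2 * (\<integral>x. (g (part2 x) - q n (part2 x))\<^sup>2 \<partial>P))
      \<longlonglongrightarrow> 2 * 0 + 2 * 0" by (intro tendsto_intros p q)
    then show "(\<lambda>n. 2 * (\<integral>x. (f (part1 x) - p n (part1 x))\<^sup>2 \<partial>P) + 2 * (\<integral>x. (g (part2 x) - q n (part2 x))\<^sup>2 \<partial>P))
      \<longlonglongrightarrow> 0" by simp
  qed simp
  have v: "(\<lambda>n. var P (\<lambda>x. p n (part1 x))) \<longlonglongrightarrow> var P (\<lambda>x. f (part1 x))"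
    "(\<lambda>n. var P (\<lambda>x. q n (part2 x))) \<longlonglongrightarrow> var P (\<lambda>x. g (part2 x))"
    "(\<lambda>n. var P (\<lambda>x. p n (part1 x) + q n (part2 x))) \<longlonglongrightarrow> var P (\<lambda>x. f (part1 x) + g (part2 x))"
    by (rule var_tendsto[OF fm f(2) trig(1)[OF tp] trig(2)[OF tp] p(2)],
        rule var_tendsto[OF gm g(2) trig(1)[OF tq] trig(2)[OF tq] q(2)],
        rule var_tendsto[OF borel_measurable_add[OF fm gm] integrable_square_add(1)[OF fm gm f(2) g(2)]
          trig(1)[OF tpq] trig(2)[OF tpq] sum_lim])
  show ?thesis
    by (rule LIMSEQ_le[OF tendsto_mult[OF tendsto_const tendsto_add[OF v(1,2)]] v(3)])
      (intro exI allI impI var_trig_poly_ge[OF l p(1) q(1)])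
qed

end

section \<open>Transfer from P to Q and the final bound\<close>

lemma integral_comp_cong_distr:
  fixes f :: "'b::euclidean_space \<Rightarrow> real"
  assumes "distr M borel X = distr N borel X" "X \<in> borel_measurable M" "X \<in> borel_measurable N"
    and "f \<in> borel_measurable borel"
  shows "(\<integral>x. f (X x) \<partial>M) = (\<integral>x. f (X x) \<partial>N)"
    "integrable M (\<lambda>x. f (X x)) \<longleftrightarrow> integrable N (\<lambda>x. f (X x))"
  using integral_distr[OF assms(2,4)] integral_distr[OF assms(3,4)]
    integrable_distr_eq[OF assms(2,4)] integrable_distr_eq[OF assms(3,4)] assms(1) by simp_all

lemma (in standardized_gaussian) second_moment_transfer:
  assumes Q: "centered_gaussian Q"
    and marg: "distr P borel part1 = distr Q borel part1" "distr P borel part2 = distr Q borel part2"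
    and l: "0 < lam"
    and f: "f \<in> borel_measurable borel" "integrable P (\<lambda>x. (f (part1 x))\<^sup>2)"
    and g: "g \<in> borel_measurable borel" "integrable P (\<lambda>x. (g (part2 x))\<^sup>2)"
  shows "(\<integral>x. (f (part1 x) + g (part2 x))\<^sup>2 \<partial>Q) \<le> 2 / lam * (\<integral>x. (f (part1 x) + g (part2 x))\<^sup>2 \<partial>P)"
    "integrable Q (\<lambda>x. (f (part1 x) + g (part2 x))\<^sup>2)" "integrable P (\<lambda>x. (f (part1 x) + g (part2 x))\<^sup>2)"
proof -
  interpret Q: gaussian_measure Q by (rule gaussian_measure.intro[OF Q])
  note qm = part_measurable[OF Q.sets_M]
  have fP: "(\<lambda>x. f (part1 x)) \<in> borel_measurable P" by (rule measurable_compose[OF part_meas(1) f(1)])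
  have gP: "(\<lambda>x. g (part2 x)) \<in> borel_measurable P" by (rule measurable_compose[OF part_meas(2) g(1)])
  have fQ: "(\<lambda>x. f (part1 x)) \<in> borel_measurable Q" by (rule measurable_compose[OF qm(1) f(1)])
  have gQ: "(\<lambda>x. g (part2 x)) \<in> borel_measurable Q" by (rule measurable_compose[OF qm(2) g(1)])
  have sq: "(\<lambda>x. (f x)\<^sup>2) \<in> borel_measurable borel" "(\<lambda>x. (g x)\<^sup>2) \<in> borel_measurable borel"
    using f(1) g(1) by simp_all
  note t1 = integral_comp_cong_distr[OF marg(1) part_meas(1) qm(1)]
  note t2 = integral_comp_cong_distr[OF marg(2) part_meas(2) qm(2)]
  have f2Q: "integrable Q (\<lambda>x. (f (part1 x))\<^sup>2)" using t1(2)[OF sq(1)] f(2) by simp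
  have g2Q: "integrable Q (\<lambda>x. (g (part2 x))\<^sup>2)" using t2(2)[OF sq(2)] g(2) by simp
  show "integrable Q (\<lambda>x. (f (part1 x) + g (part2 x))\<^sup>2)"
    by (rule Q.integrable_square_add(1)[OF fQ gQ f2Q g2Q])
  show "integrable P (\<lambda>x. (f (part1 x) + g (part2 x))\<^sup>2)"
    by (rule integrable_square_add(1)[OF fP gP f(2) g(2)])
  let ?h = "\<lambda>x. f (part1 x) + g (part2 x)"
  have var_eq: "var Q (\<lambda>x. f (part1 x)) = var P (\<lambda>x. f (part1 x))"
    "var Q (\<lambda>x. g (part2 x)) = var P (\<lambda>x. g (part2 x))"
    by (simp_all add: var_def t1(1)[OF f(1)] t1(1)[OF sq(1)] t2(1)[OF g(1)] t2(1)[OF sq(2)])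
  have mean_eq: "(\<integral>x. ?h x \<partial>Q) = (\<integral>x. ?h x \<partial>P)"
    using t1(1)[OF f(1)] t2(1)[OF g(1)]
      square_integrable_imp_integrable[OF fP f(2)] square_integrable_imp_integrable[OF gP g(2)]
      Q.square_integrable_imp_integrable[OF fQ f2Q] Q.square_integrable_imp_integrable[OF gQ g2Q]
    by simp
  have "lam * var Q ?h \<le> lam * (2 * (var Q (\<lambda>x. f (part1 x)) + var Q (\<lambda>x. g (part2 x))))"
    using l by (intro mult_left_mono Q.var_add_le fQ gQ f2Q g2Q) simp
  also have "\<dots> = 2 * (lam * (var P (\<lambda>x. f (part1 x)) + var P (\<lambda>x. g (part2 x))))"
    by (simp add: var_eq)
  also have "\<dots> \<le> 2 * var P ?h"
    using var_parts_ge[OF less_imp_le[OF l] f g] by simp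
  finally have "lam * var Q ?h \<le> 2 * var P ?h" .
  \<comment> \<open>The summands are not centred, so the squared mean, common to P and Q, is added
    back: it has coefficient \<open>lam\<close> on the left and 2 on the right.\<close>
  moreover have "lam * (\<integral>x. ?h x \<partial>P)\<^sup>2 \<le> 2 * (\<integral>x. ?h x \<partial>P)\<^sup>2"
    using lam_le_1 by (intro mult_right_mono) auto
  ultimately have "lam * (\<integral>x. (?h x)\<^sup>2 \<partial>Q) \<le> 2 * (\<integral>x. (?h x)\<^sup>2 \<partial>P)"
    unfolding var_def mean_eq right_diff_distrib by linarith
  then show "(\<integral>x. (?h x)\<^sup>2 \<partial>Q) \<le> 2 / lam * (\<integral>x. (?h x)\<^sup>2 \<partial>P)"
    using l by (simp add: field_simps)
qed

text \<open>For b = 0 the hypothesis forces a = 0, and the convention 0/0 = 0 applies.\<close>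

lemma ennreal_divide_le_of_le_mult:
  assumes "a \<le> ennreal c * b" "b \<noteq> \<infinity>"
  shows "a / b \<le> ennreal c"
proof (cases "b = 0")
  case True
  then have "a = 0" using assms by simp
  then show ?thesis by simp
next
  case False
  then have "0 < b" by (simp add: zero_less_iff_neq_zero)
  then show ?thesis using assms by (intro divide_le_posI_ennreal) (auto simp: mult.commute)
qed

theorem mainTheorem6:
  fixes P Q :: "(real ^ ('n::finite + 'm::finite)) measure"
  assumes "centered_gaussian P" and "centered_gaussian Q"
    and "distr P borel part1 = distr Q borel part1"
    and "distr P borel part2 = distr Q borel part2"
    and "\<And>i j. (\<integral>x. x $ Inl i * x $ Inl j \<partial>P) = (if i = j then 1 else 0)"
    and "\<And>i j. (\<integral>x. x $ Inr i * x $ Inr j \<partial>P) = (if i = j then 1 else 0)"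
  shows "transfer_coeff P Q (additive_class P)
           \<le> ennreal 2 / ennreal (lambda_min (second_moment P))"
proof (cases "0 < lambda_min (second_moment P)")
  case False
  \<comment> \<open>\<open>ennreal\<close> sends a nonpositive number to 0, so the right-hand side
    is 2/0, which is infinite.\<close>
  then show ?thesis by (simp add: ennreal_neg ennreal_divide_zero)
next
  case l: True
  interpret standardized_gaussian P
    by unfold_locales (fact assms)+
  have "(\<integral>\<^sup>+x. ennreal ((f x - g x)\<^sup>2) \<partial>Q) / (\<integral>\<^sup>+x. ennreal ((f x - g x)\<^sup>2) \<partial>P) \<le> ennreal (2 / lam)"
    if fg: "f \<in> additive_class P" "g \<in> additive_class P" for f g
  proof -
    obtain f1 f2 where f: "f1 \<in> borel_measurable borel" "f2 \<in> borel_measurable borel"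
      "(\<integral>\<^sup>+x. ennreal ((f1 (part1 x))\<^sup>2) \<partial>P) < \<infinity>" "(\<integral>\<^sup>+x. ennreal ((f2 (part2 x))\<^sup>2) \<partial>P) < \<infinity>"
      "f = (\<lambda>x. f1 (part1 x) + f2 (part2 x))" using fg(1) unfolding additive_class_def by blast
    obtain g1 g2 where g: "g1 \<in> borel_measurable borel" "g2 \<in> borel_measurable borel"
      "(\<integral>\<^sup>+x. ennreal ((g1 (part1 x))\<^sup>2) \<partial>P) < \<infinity>" "(\<integral>\<^sup>+x. ennreal ((g2 (part2 x))\<^sup>2) \<partial>P) < \<infinity>"
      "g = (\<lambda>x. g1 (part1 x) + g2 (part2 x))" using fg(2) unfolding additive_class_def by blast
    have m1: "(\<lambda>x. u (part1 x)) \<in> borel_measurable P" if "u \<in> borel_measurable borel" for u :: "_ \<Rightarrow> real"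
      by (rule measurable_compose[OF part_meas(1) that])
    have m2: "(\<lambda>x. u (part2 x)) \<in> borel_measurable P" if "u \<in> borel_measurable borel" for u :: "_ \<Rightarrow> real"
      by (rule measurable_compose[OF part_meas(2) that])
    have sq: "integrable P (\<lambda>x. (u x)\<^sup>2)"
      if "u \<in> borel_measurable P" "(\<integral>\<^sup>+x. ennreal ((u x)\<^sup>2) \<partial>P) < \<infinity>" for u
      by (rule integrableI_nonneg) (use that in auto)
    \<comment> \<open>Differences of additive functions are additive, so the supremum over pairs
      concerns a single function of the form handled by
      \<open>second_moment_transfer\<close>.\<close>
    define u1 u2 where "u1 y = f1 y - g1 y" and "u2 z = f2 z - g2 z" for y z
    have h: "f x - g x = u1 (part1 x) + u2 (part2 x)" for x
      by (simp add: f(5) g(5) u1_def u2_def)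
    have u: "u1 \<in> borel_measurable borel" "u2 \<in> borel_measurable borel"
      unfolding u1_def[abs_def] u2_def[abs_def] using f(1,2) g(1,2) by simp_all
    have u1: "integrable P (\<lambda>x. (u1 (part1 x))\<^sup>2)" unfolding u1_def
      by (rule integrable_square_add(2)[OF m1[OF f(1)] m1[OF g(1)] sq[OF m1[OF f(1)] f(3)] sq[OF m1[OF g(1)] g(3)]])
    have u2: "integrable P (\<lambda>x. (u2 (part2 x))\<^sup>2)" unfolding u2_def
      by (rule integrable_square_add(2)[OF m2[OF f(2)] m2[OF g(2)] sq[OF m2[OF f(2)] f(4)] sq[OF m2[OF g(2)] g(4)]])
    note tr = second_moment_transfer[OF assms(2-4) l u(1) u1 u(2) u2]
    have "ennreal (\<integral>x. (u1 (part1 x) + u2 (part2 x))\<^sup>2 \<partial>Q)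
      \<le> ennreal (2 / lam) * ennreal (\<integral>x. (u1 (part1 x) + u2 (part2 x))\<^sup>2 \<partial>P)"
      using tr(1) l by (simp add: ennreal_mult[symmetric] ennreal_leI)
    then show ?thesis
      unfolding h using tr(2,3)
      by (intro ennreal_divide_le_of_le_mult) (simp_all add: nn_integral_eq_integral)
  qed
  then have "transfer_coeff P Q (additive_class P) \<le> ennreal (2 / lam)"
    unfolding transfer_coeff_def by (intro SUP_least)
  moreover have "ennreal 2 / ennreal lam = ennreal (2 / lam)" using l by (intro divide_ennreal) auto
  ultimately show ?thesis by (simp only:)
qed

end
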